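(* Let $X_1,\dots,X_n$ be i.i.d. random vectors in $\mathbb{R}^d$ with $\mathbb{E}X_k=0$ and $\|X_{k,i}\|_{\psi_2}\le\sigma$ for all $i\in[d]$, with covariance matrix $\Sigma^*=[\sigma^*_{ij}]=\mathbb{E}X_kX_k^T$ that is approximately column-wise sparse: for some $0\le q<1$ and $s>0$, $\sup_{j\in[d]}\sum_{i=1}^d|\sigma^*_{ij}|^q\le s$. Let $\delta\ge 4$, assume $n>2\delta\log d$, let $$\gamma=C_1\sigma\sqrt{\log\Big(\frac{n}{2\delta\log d}\Big)},\qquad \zeta=C_2\sigma^2\log n\sqrt{\frac{\delta\log d}{n}}$$ with $C_1,C_2$ sufficiently large constants, and assume $\gamma>\sigma$ and that $\delta\log d(\log n)^2/n$ is sufficiently small. Let $\breve\Sigma=\frac{\gamma^2}{2n}\sum_{k=1}^n(\dot X_{k1}\dot X_{k2}^T+\dot X_{k2}\dot X_{k1}^T)$ be built from the dithered 1-bit data $\dot X_{kj}=\mathrm{sign}(X_k+\Gamma_{kj})$, $j=1,2$, with dithering scale $\gamma$, and let $\widehat\Sigma=\mathcal{T}_\zeta\breve\Sigma$ be its entrywise hard thresholding. Then with $p=\delta/4$, $$\Big(\mathbb{E}\|\widehat\Sigma-\Sigma^*\|_{\mathrm{op}}^p\Big)^{1/p}\lesssim s\Big(\sigma^2\log n\sqrt{\frac{\delta\log d}{n}}\Big)^{1-q},$$ and moreover $$\mathbb{P}\Big(\|\widehat\Sigma-\Sigma^*\|_{\mathrm{op}}\lesssim s\Big[\sigma^2\log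 n\sqrt{\frac{\delta\log d}{n}}\Big]^{1-q}\Big)\ge 1-\exp(-\delta).$$
   Context: $[d]=\{1,\dots,d\}$; $X_{k,i}$ is the $i$-th entry of $X_k$. $\|Z\|_{\psi_2}=\inf\{t>0:\mathbb{E}\exp(Z^2/t^2)\le 2\}$. $\|\cdot\|_{\mathrm{op}}$ is the operator (spectral) norm. $\mathrm{sign}(x)=1$ if $x\ge0$, $-1$ if $x<0$, applied entrywise. Hard thresholding: $\mathcal{T}_\zeta(x)=x\,\mathbf{1}(|x|\ge\zeta)$, applied entrywise. For $q=0$ the sum $\sum_i|\sigma^*_{ij}|^q$ counts the nonzero entries of the $j$-th column. The dithers $\Gamma_{k1},\Gamma_{k2}$ ($k\in[n]$) are i.i.d. uniform on $[-\gamma,\gamma]^d$ and independent of $(X_k)_{k\in[n]}$. $A\lesssim B$ means $A\le KB$ for an absolute constant $K$, where $C_1,C_2$ are regarded as fixed absolute constants.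
   Formalization: The moment bound is proved under the added condition s ≥ (σ² log n √(δ log d/n))^q; without a lower bound on s it is false (X_k = 0, s → 0, since the estimator is nonzero with positive probability). The probability bound is unrestricted. *)

theory Defs
  imports "HOL-Probability.Probability"
begin

text \<open>
  Vectors of dimension \<open>d\<close> are functions on the index set \<open>{..<d}\<close>, and matrices are functions
  of two indices. The dimension is a number and not a type because the constants of the
  theorem must not depend on it.
\<close>

definition vec_space :: "nat \<Rightarrow> (nat \<Rightarrow> real) measure" where
  "vec_space d = PiM {..<d} (\<lambda>_. borel)"

text \<open>
  The infimum is taken in \<^typ>\<open>ennreal\<close>, so that a variable that is not
  sub-Gaussian has norm \<open>\<infinity>\<close>; on the reals the infimum of the empty set would be arbitrary.
\<close>

definition psi2_norm :: "'w measure \<Rightarrow> ('w \<Rightarrow> real) \<Rightarrow> ennreal" where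
  "psi2_norm M Z =
     Inf {ennreal t | t. 0 < t \<and> (\<integral>\<^sup>+ \<omega>. ennreal (exp ((Z \<omega>)\<^sup>2 / t\<^sup>2)) \<partial>M) \<le> 2}"

definition second_moment :: "'w measure \<Rightarrow> ('w \<Rightarrow> nat \<Rightarrow> real) \<Rightarrow> nat \<Rightarrow> nat \<Rightarrow> real" where
  "second_moment M Y i j = (\<integral>\<omega>. Y \<omega> i * Y \<omega> j \<partial>M)"

definition uniform_cube :: "nat \<Rightarrow> real \<Rightarrow> (nat \<Rightarrow> real) measure" where
  "uniform_cube d \<gamma> =
     uniform_measure (PiM {..<d} (\<lambda>_. lborel)) (PiE {..<d} (\<lambda>_. {-\<gamma>..\<gamma>}))"

definition op_norm :: "nat \<Rightarrow> (nat \<Rightarrow> nat \<Rightarrow> real) \<Rightarrow> real" where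
  "op_norm d A =
     (SUP x\<in>{x. L2_set x {..<d} \<le> 1}. L2_set (\<lambda>i. \<Sum>j<d. A i j * x j) {..<d})"

text \<open>The library function \<^const>\<open>sgn\<close> vanishes at \<open>0\<close>, whereas the quantizer takes the value \<open>1\<close>.\<close>

definition sign1 :: "real \<Rightarrow> real" where
  "sign1 x = (if 0 \<le> x then 1 else - 1)"

definition hard_threshold :: "real \<Rightarrow> real \<Rightarrow> real" where
  "hard_threshold \<zeta> x = (if \<zeta> \<le> \<bar>x\<bar> then x else 0)"

definition iid_sample :: "'w measure \<Rightarrow> nat \<Rightarrow> nat \<Rightarrow> (nat \<Rightarrow> 'w \<Rightarrow> nat \<Rightarrow> real) \<Rightarrow> bool" where
  "iid_sample M d n X \<longleftrightarrow>
     prob_space.indep_vars M (\<lambda>_. vec_space d) X {..<n} \<and>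
     (\<forall>k<n. distr M (vec_space d) (X k) = distr M (vec_space d) (X 0))"

text \<open>\<open>\<Gamma> k 1\<close> and \<open>\<Gamma> k 2\<close> are the two dithers of the \<open>k\<close>-th sample.\<close>

definition uniform_dithers ::
  "'w measure \<Rightarrow> nat \<Rightarrow> nat \<Rightarrow> real \<Rightarrow> (nat \<Rightarrow> nat \<Rightarrow> 'w \<Rightarrow> nat \<Rightarrow> real) \<Rightarrow> bool" where
  "uniform_dithers M d n \<gamma> \<Gamma> \<longleftrightarrow>
     prob_space.indep_vars M (\<lambda>_. vec_space d) (\<lambda>(k, j). \<Gamma> k j) ({..<n} \<times> {1, 2}) \<and>
     (\<forall>k<n. \<forall>j\<in>{1, 2}. distr M (vec_space d) (\<Gamma> k j) = uniform_cube d \<gamma>)"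

text \<open>
  The generated \<open>\<sigma>\<close>-algebras are independent; the library's \<open>indep_var\<close> does not apply because
  the two families take values in different types.
\<close>

definition dithers_indep_sample ::
  "'w measure \<Rightarrow> nat \<Rightarrow> nat \<Rightarrow> (nat \<Rightarrow> 'w \<Rightarrow> nat \<Rightarrow> real) \<Rightarrow>
     (nat \<Rightarrow> nat \<Rightarrow> 'w \<Rightarrow> nat \<Rightarrow> real) \<Rightarrow> bool" where
  "dithers_indep_sample M d n X \<Gamma> \<longleftrightarrow>
     prob_space.indep_set M
       {(\<lambda>\<omega>. \<lambda>k\<in>{..<n}. X k \<omega>) -` A \<inter> space M | A.
          A \<in> sets (PiM {..<n} (\<lambda>_. vec_space d))}
       {(\<lambda>\<omega>. \<lambda>(k, j)\<in>{..<n} \<times> {1, 2}. \<Gamma> k j \<omega>) -` B \<inter> space M | B.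
          B \<in> sets (PiM ({..<n} \<times> {1, 2}) (\<lambda>_. vec_space d))}"

definition one_bit ::
  "(nat \<Rightarrow> 'w \<Rightarrow> nat \<Rightarrow> real) \<Rightarrow> (nat \<Rightarrow> nat \<Rightarrow> 'w \<Rightarrow> nat \<Rightarrow> real) \<Rightarrow>
     nat \<Rightarrow> nat \<Rightarrow> 'w \<Rightarrow> nat \<Rightarrow> real" where
  "one_bit X \<Gamma> k j \<omega> i = sign1 (X k \<omega> i + \<Gamma> k j \<omega> i)"

definition one_bit_cov ::
  "nat \<Rightarrow> real \<Rightarrow> (nat \<Rightarrow> 'w \<Rightarrow> nat \<Rightarrow> real) \<Rightarrow> (nat \<Rightarrow> nat \<Rightarrow> 'w \<Rightarrow> nat \<Rightarrow> real) \<Rightarrow>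
     'w \<Rightarrow> nat \<Rightarrow> nat \<Rightarrow> real" where
  "one_bit_cov n \<gamma> X \<Gamma> \<omega> i j =
     \<gamma>\<^sup>2 / (2 * real n) *
       (\<Sum>k<n. one_bit X \<Gamma> k 1 \<omega> i * one_bit X \<Gamma> k 2 \<omega> j
            + one_bit X \<Gamma> k 2 \<omega> i * one_bit X \<Gamma> k 1 \<omega> j)"

definition estimation_error ::
  "'w measure \<Rightarrow> nat \<Rightarrow> nat \<Rightarrow> real \<Rightarrow> real \<Rightarrow> (nat \<Rightarrow> 'w \<Rightarrow> nat \<Rightarrow> real) \<Rightarrow>
     (nat \<Rightarrow> nat \<Rightarrow> 'w \<Rightarrow> nat \<Rightarrow> real) \<Rightarrow> 'w \<Rightarrow> real" where
  "estimation_error M d n \<gamma> \<zeta> X \<Gamma> \<omega> =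
     op_norm d (\<lambda>i j. hard_threshold \<zeta> (one_bit_cov n \<gamma> X \<Gamma> \<omega> i j) - second_moment M (X 0) i j)"

text \<open>
  Since \<open>0 powr 0 = 0\<close> and \<open>x powr 0 = 1\<close> for \<open>x > 0\<close>, the sum counts the nonzero entries of the
  column when \<open>q = 0\<close>.
\<close>

definition approx_sparse :: "nat \<Rightarrow> real \<Rightarrow> real \<Rightarrow> (nat \<Rightarrow> nat \<Rightarrow> real) \<Rightarrow> bool" where
  "approx_sparse d q s A \<longleftrightarrow> (\<forall>j<d. (\<Sum>i<d. \<bar>A i j\<bar> powr q) \<le> s)"

text \<open>
  This quantity is at once the unit of the threshold and the base of the error rate. The moment
  bound is stated for \<open>noise_level powr q \<le> s\<close>, that is, when the rate is at least the noise
  level of a single entry. Without a lower bound on \<open>s\<close> it fails: for \<open>X = 0\<close> every \<open>s > 0\<close> is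
  admissible, while with positive probability all signs agree and the estimator is not zero.
\<close>

definition noise_level :: "real \<Rightarrow> real \<Rightarrow> nat \<Rightarrow> nat \<Rightarrow> real" where
  "noise_level \<sigma> \<delta> d n = \<sigma>\<^sup>2 * ln (real n) * sqrt (\<delta> * ln (real d) / real n)"

end

theory Submission
  imports Defs
begin

text \<open>
  Integrating out a dither turns a sign into a clipped entry, so the mean of the one-bit
  covariance is the covariance of the data clipped at \<open>\<gamma>\<close>; by the sub-Gaussian tails its bias is
  at most \<open>32 \<sigma>\<^sup>2 exp (- \<gamma>\<^sup>2 / (8 \<sigma>\<^sup>2))\<close>, which the choice of \<open>\<gamma>\<close> makes smaller than a quarter of the
  threshold \<open>\<zeta>\<close>. Hoeffding's inequality and a union bound then show that all entries are within
  \<open>\<zeta> / 2\<close> of the truth except with probability \<open>exp (- \<delta>)\<close>. On that event an entry \<open>a\<close> of the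
  covariance is estimated with error at most \<open>3/2 * \<bar>a\<bar> powr q * \<zeta> powr (1 - q)\<close>, and the sparsity
  bounds the row and column sums of the error, hence its operator norm. For the moment bound the
  complementary event is cut into levels according to the size of the largest entrywise error in
  units of \<open>\<zeta> / 2\<close>.
\<close>

subsection \<open>Operator norm and thresholding\<close>

text \<open>Cauchy-Schwarz with \<open>\<bar>A i j\<bar>\<close> split into two square roots: one
  factor gives a row sum, the other carries \<open>x\<close>. Summing over \<open>i\<close> and
  exchanging the sums leaves column sums.\<close>

lemma Schur_test:
  fixes A :: "nat \<Rightarrow> nat \<Rightarrow> real"
  assumes row: "\<And>i. i < d \<Longrightarrow> (\<Sum>j<d. \<bar>A i j\<bar>) \<le> B"
    and col: "\<And>j. j < d \<Longrightarrow> (\<Sum>i<d. \<bar>A i j\<bar>) \<le> B"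
    and B: "0 \<le> B"
  shows "L2_set (\<lambda>i. \<Sum>j<d. A i j * x j) {..<d} \<le> B * L2_set x {..<d}"
proof (rule power2_le_imp_le)
  have entry: "(\<Sum>j<d. A i j * x j)\<^sup>2 \<le> B * (\<Sum>j<d. \<bar>A i j\<bar> * (x j)\<^sup>2)" if i: "i < d" for i
  proof -
    let ?f = "\<lambda>j. sqrt \<bar>A i j\<bar>" and ?g = "\<lambda>j. sqrt \<bar>A i j\<bar> * \<bar>x j\<bar>"
    have "\<bar>\<Sum>j<d. A i j * x j\<bar> \<le> (\<Sum>j<d. \<bar>A i j * x j\<bar>)"
      by (rule sum_abs)
    also have "\<dots> = (\<Sum>j<d. \<bar>?f j\<bar> * \<bar>?g j\<bar>)"
      by (simp add: abs_mult flip: mult.assoc)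
    also have "\<dots> \<le> L2_set ?f {..<d} * L2_set ?g {..<d}"
      by (rule L2_set_mult_ineq)
    finally have "(\<Sum>j<d. A i j * x j)\<^sup>2 \<le> (L2_set ?f {..<d} * L2_set ?g {..<d})\<^sup>2"
      by (metis abs_ge_zero power2_abs power_mono)
    also have "\<dots> = (\<Sum>j<d. \<bar>A i j\<bar>) * (\<Sum>j<d. \<bar>A i j\<bar> * (x j)\<^sup>2)"
      by (simp add: L2_set_def power_mult_distrib sum_nonneg)
    also have "\<dots> \<le> B * (\<Sum>j<d. \<bar>A i j\<bar> * (x j)\<^sup>2)"
      using row[OF i] by (intro mult_right_mono sum_nonneg) auto
    finally show ?thesis .
  qed
  have "(L2_set (\<lambda>i. \<Sum>j<d. A i j * x j) {..<d})\<^sup>2 = (\<Sum>i<d. (\<Sum>j<d. A i j * x j)\<^sup>2)"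
    by (simp add: L2_set_def sum_nonneg)
  also have "\<dots> \<le> (\<Sum>i<d. B * (\<Sum>j<d. \<bar>A i j\<bar> * (x j)\<^sup>2))"
    by (intro sum_mono entry) auto
  also have "\<dots> = B * (\<Sum>j<d. (\<Sum>i<d. \<bar>A i j\<bar>) * (x j)\<^sup>2)"
    by (simp add: sum_distrib_left[symmetric] sum_distrib_right) (subst sum.swap, simp)
  also have "\<dots> \<le> B * (\<Sum>j<d. B * (x j)\<^sup>2)"
    using col B by (intro mult_left_mono sum_mono mult_right_mono) auto
  also have "\<dots> = (B * L2_set x {..<d})\<^sup>2"
    by (simp add: L2_set_def sum_nonneg power_mult_distrib power2_eq_square
        sum_distrib_left[symmetric])
  finally show "(L2_set (\<lambda>i. \<Sum>j<d. A i j * x j) {..<d})\<^sup>2 \<le> (B * L2_set x {..<d})\<^sup>2" .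
qed (use B in \<open>simp add: L2_set_nonneg\<close>)

lemma op_norm_le:
  assumes "\<And>i. i < d \<Longrightarrow> (\<Sum>j<d. \<bar>A i j\<bar>) \<le> B"
    and "\<And>j. j < d \<Longrightarrow> (\<Sum>i<d. \<bar>A i j\<bar>) \<le> B"
    and B: "0 \<le> B"
  shows "op_norm d A \<le> B"
  unfolding op_norm_def
proof (rule cSUP_least)
  have "(\<lambda>_. 0) \<in> {x. L2_set x {..<d} \<le> 1}"
    by (simp add: L2_set_def)
  then show "{x. L2_set x {..<d} \<le> 1} \<noteq> {}"
    by blast
next
  fix x assume "x \<in> {x. L2_set x {..<d} \<le> 1}"
  then have "B * L2_set x {..<d} \<le> B"
    using B by (simp add: mult_left_le)
  with Schur_test[OF assms] show "L2_set (\<lambda>i. \<Sum>j<d. A i j * x j) {..<d} \<le> B"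
    by (rule order_trans)
qed

text \<open>The value at \<open>x = 0\<close> bounds the real supremum from below once the set is
  known to be bounded above. The sum of all \<open>\<bar>A i j\<bar>\<close> dominates every row and
  column sum, so \<open>Schur_test\<close> supplies that bound.\<close>

lemma op_norm_nonneg: "0 \<le> op_norm d A"
proof -
  define B where "B = (\<Sum>i<d. \<Sum>j<d. \<bar>A i j\<bar>)"
  have row: "(\<Sum>j<d. \<bar>A i j\<bar>) \<le> B" if "i < d" for i
    unfolding B_def using that by (intro member_le_sum[of i _ "\<lambda>i. \<Sum>j<d. \<bar>A i j\<bar>"]) (auto intro: sum_nonneg)
  have col: "(\<Sum>i<d. \<bar>A i j\<bar>) \<le> B" if "j < d" for j
    unfolding B_def using that
    by (subst sum.swap, intro member_le_sum[of j _ "\<lambda>j. \<Sum>i<d. \<bar>A i j\<bar>"]) (auto intro: sum_nonneg)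
  have "0 \<le> B"
    unfolding B_def by (intro sum_nonneg) auto
  have "bdd_above ((\<lambda>x. L2_set (\<lambda>i. \<Sum>j<d. A i j * x j) {..<d}) ` {x. L2_set x {..<d} \<le> 1})"
  proof (rule bdd_aboveI2)
    fix x assume "x \<in> {x. L2_set x {..<d} \<le> 1}"
    then have "B * L2_set x {..<d} \<le> B"
      using \<open>0 \<le> B\<close> by (simp add: mult_left_le)
    with Schur_test[OF row col \<open>0 \<le> B\<close>]
    show "L2_set (\<lambda>i. \<Sum>j<d. A i j * x j) {..<d} \<le> B"
      by (rule order_trans)
  qed
  then have "L2_set (\<lambda>i. \<Sum>j<d. A i j * (\<lambda>_. 0) j) {..<d} \<le> op_norm d A"
    unfolding op_norm_def by (rule cSUP_upper[rotated]) (simp add: L2_set_def)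
  then show ?thesis
    by (simp add: L2_set_def)
qed

lemma op_norm_cong:
  assumes "\<And>i j. i < d \<Longrightarrow> j < d \<Longrightarrow> A i j = B i j"
  shows "op_norm d A = op_norm d B"
  unfolding op_norm_def using assms
  by (intro SUP_cong refl L2_set_cong sum.cong) auto

text \<open>If \<open>t\<close> is kept, then \<open>\<bar>a\<bar>\<close> is at least
  \<open>\<zeta> / 2\<close>, and the error \<open>\<zeta> / 2\<close> is split into powers
  \<open>q\<close> and \<open>1 - q\<close>, the first of which is at most
  \<open>\<bar>a\<bar> powr q\<close>. If \<open>t\<close> is cut, then \<open>\<bar>a\<bar>\<close>
  is at most \<open>3/2 * \<zeta>\<close> and is itself the error; it is split in the same
  way.\<close>

lemma hard_threshold_error:
  assumes "\<bar>t - a\<bar> \<le> \<zeta> / 2" "0 < \<zeta>" "0 \<le> q" "q < 1"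
  shows "\<bar>hard_threshold \<zeta> t - a\<bar> \<le> 3/2 * (\<bar>a\<bar> powr q * \<zeta> powr (1 - q))"
proof (cases "\<zeta> \<le> \<bar>t\<bar>")
  case True
  then have a: "\<zeta> / 2 \<le> \<bar>a\<bar>"
    using assms by linarith
  have "\<bar>hard_threshold \<zeta> t - a\<bar> \<le> \<zeta> / 2"
    using True assms by (simp add: hard_threshold_def)
  also have "\<dots> = (\<zeta> / 2) powr q * (\<zeta> / 2) powr (1 - q)"
    using assms by (simp flip: powr_add)
  also have "\<dots> \<le> \<bar>a\<bar> powr q * \<zeta> powr (1 - q)"
    using a assms by (intro mult_mono powr_mono2) auto
  also have "\<dots> \<le> 3/2 * \<dots>"
    by simp
  finally show ?thesis .
next
  case False
  then have a: "\<bar>a\<bar> \<le> 3/2 * \<zeta>"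
    using assms by linarith
  have "\<bar>hard_threshold \<zeta> t - a\<bar> = \<bar>a\<bar>"
    using False by (simp add: hard_threshold_def)
  also have "\<dots> \<le> \<bar>a\<bar> powr q * (3/2 * \<zeta> powr (1 - q))"
  proof (cases "a = 0")
    case False
    have "\<bar>a\<bar> = \<bar>a\<bar> powr q * \<bar>a\<bar> powr (1 - q)"
      using False by (simp flip: powr_add)
    also have "\<dots> \<le> \<bar>a\<bar> powr q * (3/2 * \<zeta>) powr (1 - q)"
      using a assms by (intro mult_left_mono powr_mono2) auto
    also have "(3/2 * \<zeta>) powr (1 - q) = (3/2) powr (1 - q) * \<zeta> powr (1 - q)"
      using assms by (intro powr_mult)
    also have "(3/2 :: real) powr (1 - q) \<le> (3/2) powr 1"
      using assms by (intro powr_mono) auto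
    finally show ?thesis
      by (simp add: mult_left_mono mult_right_mono)
  qed simp
  finally show ?thesis
    by (simp add: mult_ac)
qed

lemma hard_threshold_error_trivial: "0 \<le> \<zeta> \<Longrightarrow> \<bar>hard_threshold \<zeta> t - a\<bar> \<le> \<bar>t - a\<bar> + \<zeta>"
  by (auto simp: hard_threshold_def)

text \<open>The entrywise bound depends on \<open>A\<close> alone, so sparsity bounds the column
  sums of the error and the symmetry of \<open>A\<close> transfers this to the row sums.\<close>

lemma op_norm_hard_threshold:
  assumes sparse: "approx_sparse d q s A"
    and sym: "\<And>i j. A i j = A j i"
    and close: "\<And>i j. i < d \<Longrightarrow> j < d \<Longrightarrow> \<bar>S i j - A i j\<bar> \<le> \<zeta> / 2"
    and "0 < \<zeta>" "0 \<le> q" "q < 1" "0 < s"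
  shows "op_norm d (\<lambda>i j. hard_threshold \<zeta> (S i j) - A i j) \<le> 3/2 * (s * \<zeta> powr (1 - q))"
proof -
  let ?E = "\<lambda>i j. \<bar>hard_threshold \<zeta> (S i j) - A i j\<bar>"
  have entry: "?E i j \<le> 3/2 * (\<bar>A i j\<bar> powr q * \<zeta> powr (1 - q))" if "i < d" "j < d" for i j
    using that assms by (intro hard_threshold_error) auto
  have col: "(\<Sum>i<d. 3/2 * (\<bar>A i j\<bar> powr q * \<zeta> powr (1 - q))) \<le> 3/2 * (s * \<zeta> powr (1 - q))"
    if "j < d" for j
  proof -
    have "(\<Sum>i<d. \<bar>A i j\<bar> powr q) * \<zeta> powr (1 - q) \<le> s * \<zeta> powr (1 - q)"
      using sparse that unfolding approx_sparse_def by (intro mult_right_mono) auto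
    then show ?thesis
      unfolding sum_distrib_left[symmetric] sum_distrib_right[symmetric] by (simp add: mult_ac)
  qed
  show ?thesis
  proof (rule op_norm_le)
    fix j assume j: "j < d"
    have "(\<Sum>i<d. ?E i j) \<le> (\<Sum>i<d. 3/2 * (\<bar>A i j\<bar> powr q * \<zeta> powr (1 - q)))"
      using j by (intro sum_mono entry) auto
    with col[OF j] show "(\<Sum>i<d. ?E i j) \<le> 3/2 * (s * \<zeta> powr (1 - q))"
      by linarith
  next
    fix i assume i: "i < d"
    \<comment> \<open>Row \<open>i\<close> of the error is compared with column \<open>i\<close> of
      \<open>A\<close>.\<close>
    have "(\<Sum>j<d. ?E i j) \<le> (\<Sum>j<d. 3/2 * (\<bar>A j i\<bar> powr q * \<zeta> powr (1 - q)))"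
      using i entry sym by (intro sum_mono) (metis lessThan_iff)
    with col[OF i] show "(\<Sum>j<d. ?E i j) \<le> 3/2 * (s * \<zeta> powr (1 - q))"
      by linarith
  qed (use assms in simp)
qed

text \<open>Meant for the outcomes with large entrywise error, where a factor \<open>d\<close> is
  affordable.\<close>

lemma op_norm_hard_threshold_trivial:
  assumes close: "\<And>i j. i < d \<Longrightarrow> j < d \<Longrightarrow> \<bar>S i j - A i j\<bar> \<le> D"
    and "0 \<le> \<zeta>" "0 \<le> D"
  shows "op_norm d (\<lambda>i j. hard_threshold \<zeta> (S i j) - A i j) \<le> real d * (D + \<zeta>)"
proof -
  have entry: "\<bar>hard_threshold \<zeta> (S i j) - A i j\<bar> \<le> D + \<zeta>" if "i < d" "j < d" for i j
    using hard_threshold_error_trivial[of \<zeta> "S i j" "A i j"] close[OF that] assms by linarith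
  show ?thesis
  proof (rule op_norm_le)
    show "(\<Sum>j<d. \<bar>hard_threshold \<zeta> (S i j) - A i j\<bar>) \<le> real d * (D + \<zeta>)" if "i < d" for i
      using sum_bounded_above[of "{..<d}" "\<lambda>j. \<bar>hard_threshold \<zeta> (S i j) - A i j\<bar>" "D + \<zeta>"] entry that
      by simp
    show "(\<Sum>i<d. \<bar>hard_threshold \<zeta> (S i j) - A i j\<bar>) \<le> real d * (D + \<zeta>)" if "j < d" for j
      using sum_bounded_above[of "{..<d}" "\<lambda>i. \<bar>hard_threshold \<zeta> (S i j) - A i j\<bar>" "D + \<zeta>"] entry that
      by simp
  qed (use assms in simp)
qed

subsection \<open>Dithers, independence and truncation\<close>

text \<open>Projection onto the interval from \<open>- \<gamma>\<close> to \<open>\<gamma>\<close>;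
  divided by \<open>\<gamma>\<close> it is the mean of the sign of \<open>x\<close> plus a uniform
  dither.\<close>

definition clip :: "real \<Rightarrow> real \<Rightarrow> real" where
  "clip \<gamma> x = max (- \<gamma>) (min \<gamma> x)"

lemma borel_measurable_clip [measurable]: "clip \<gamma> \<in> borel_measurable borel"
  unfolding clip_def[abs_def] by measurable

lemma borel_measurable_sign1 [measurable]: "sign1 \<in> borel_measurable borel"
  unfolding sign1_def[abs_def] by measurable

lemma abs_sign1 [simp]: "\<bar>sign1 x\<bar> = 1"
  by (simp add: sign1_def)

lemma sets_uniform_cube [simp, measurable_cong]: "sets (uniform_cube d \<gamma>) = sets (vec_space d)"
  by (auto simp: uniform_cube_def vec_space_def intro!: sets_PiM_cong)

lemma vec_space_component [measurable]: "i < d \<Longrightarrow> (\<lambda>x. x i) \<in> borel_measurable (vec_space d)"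
  unfolding vec_space_def by measurable

text \<open>The sides may differ because a half-space cuts the cube into a box with one shorter
  side.\<close>

lemma emeasure_cube:
  fixes d :: nat
  assumes "\<And>i. i < d \<Longrightarrow> l i \<le> u i"
  shows "emeasure (PiM {..<d} (\<lambda>_. lborel :: real measure)) (PiE {..<d} (\<lambda>i. {l i..u i}))
    = ennreal (\<Prod>i<d. u i - l i)"
proof -
  interpret product_sigma_finite "\<lambda>_. lborel :: real measure" ..
  have "emeasure (PiM {..<d} (\<lambda>_. lborel :: real measure)) (PiE {..<d} (\<lambda>i. {l i..u i}))
      = (\<Prod>i<d. emeasure lborel {l i..u i})"
    by (rule emeasure_PiM) auto
  also have "\<dots> = (\<Prod>i<d. ennreal (u i - l i))"
    using assms by (intro prod.cong) auto
  also have "\<dots> = ennreal (\<Prod>i<d. u i - l i)"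
    using assms by (intro prod_ennreal) auto
  finally show ?thesis .
qed

lemma prob_space_uniform_cube:
  assumes "0 < \<gamma>"
  shows "prob_space (uniform_cube d \<gamma>)"
  unfolding uniform_cube_def
  by (rule prob_space_uniform_measure; subst emeasure_cube) (use assms in auto)

text \<open>The condition on coordinate \<open>i\<close> shortens that side to the interval from
  \<open>- clip \<gamma> x\<close> to \<open>\<gamma>\<close>; all other sides cancel in the
  quotient of the volumes.\<close>

lemma measure_uniform_cube_halfspace:
  assumes i: "i < d" and \<gamma>: "0 < \<gamma>"
  shows "measure (uniform_cube d \<gamma>) {g \<in> space (vec_space d). - x \<le> g i} = (clip \<gamma> x + \<gamma>) / (2 * \<gamma>)"
proof -
  let ?P = "PiM {..<d} (\<lambda>_. lborel :: real measure)"
  let ?Q = "PiE {..<d} (\<lambda>_. {- \<gamma>..\<gamma>})"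
  define l where "l j = (if j = i then - clip \<gamma> x else - \<gamma>)" for j
  have meas: "{g \<in> space (vec_space d). - x \<le> g i} \<in> sets ?P"
    using i by (subst sets_PiM_cong[OF refl, of _ _ "\<lambda>_. borel"])
      (auto simp flip: vec_space_def)
  have l: "l j \<le> \<gamma>" for j
    using \<gamma> by (auto simp: l_def clip_def)
  have prod: "(\<Prod>j<d. \<gamma> - l j) = (\<gamma> + clip \<gamma> x) * (2 * \<gamma>) ^ (d - 1)"
  proof -
    have "(\<Prod>j<d. \<gamma> - l j) = (\<gamma> - l i) * (\<Prod>j\<in>{..<d} - {i}. \<gamma> - l j)"
      using i by (intro prod.remove) auto
    also have "(\<Prod>j\<in>{..<d} - {i}. \<gamma> - l j) = (\<Prod>j\<in>{..<d} - {i}. 2 * \<gamma>)"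
      by (intro prod.cong) (auto simp: l_def)
    finally show ?thesis
      using i by (simp add: l_def)
  qed
  \<comment> \<open>For \<open>x < - \<gamma>\<close> the left side is empty while the right side is
    a face of the cube, hence the condition.\<close>
  have set_eq: "?Q \<inter> {g \<in> space (vec_space d). - x \<le> g i} = PiE {..<d} (\<lambda>j. {l j..\<gamma>})"
    if "- \<gamma> \<le> x"
  proof (intro set_eqI iffI)
    fix g assume "g \<in> ?Q \<inter> {g \<in> space (vec_space d). - x \<le> g i}"
    then have "g \<in> ?Q" "- x \<le> g i"
      by auto
    moreover from this have "- clip \<gamma> x \<le> g i"
      using i that by (auto simp: PiE_iff clip_def max_def min_def)
    ultimately show "g \<in> PiE {..<d} (\<lambda>j. {l j..\<gamma>})"
      by (auto simp: PiE_iff l_def)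
  next
    fix g assume g: "g \<in> PiE {..<d} (\<lambda>j. {l j..\<gamma>})"
    moreover have "- \<gamma> \<le> l j" for j
      using \<gamma> by (auto simp: l_def clip_def)
    ultimately have "g \<in> ?Q"
      unfolding PiE_iff by (meson atLeastAtMost_iff order_trans)
    moreover have "- x \<le> g i"
      using g i that by (force simp: PiE_iff l_def clip_def)
    ultimately show "g \<in> ?Q \<inter> {g \<in> space (vec_space d). - x \<le> g i}"
      by (auto simp: vec_space_def space_PiM)
  qed
  have "emeasure (uniform_cube d \<gamma>) {g \<in> space (vec_space d). - x \<le> g i}
      = emeasure ?P (?Q \<inter> {g \<in> space (vec_space d). - x \<le> g i}) / emeasure ?P ?Q"
    unfolding uniform_cube_def using meas
    by (intro emeasure_uniform_measure) (auto intro!: sets_PiM_I_finite)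
  also have "emeasure ?P (?Q \<inter> {g \<in> space (vec_space d). - x \<le> g i}) = ennreal (\<Prod>j<d. \<gamma> - l j)"
  proof (cases "- \<gamma> \<le> x")
    case True
    show ?thesis
      unfolding set_eq[OF True] by (rule emeasure_cube) (rule l)
  next
    \<comment> \<open>The intersection is empty, and the product vanishes too because side
      \<open>i\<close> has length 0.\<close>
    case False
    then have "?Q \<inter> {g \<in> space (vec_space d). - x \<le> g i} = {}"
      using i by (force simp: PiE_iff)
    moreover have "clip \<gamma> x = - \<gamma>"
      using False \<gamma> by (simp add: clip_def)
    ultimately show ?thesis
      by (simp add: prod)
  qed
  also have "emeasure ?P ?Q = ennreal ((2 * \<gamma>) ^ d)"
    using \<gamma> by (subst emeasure_cube) auto
  also have "ennreal (\<Prod>j<d. \<gamma> - l j) / ennreal ((2 * \<gamma>) ^ d) = ennreal ((\<Prod>j<d. \<gamma> - l j) / (2 * \<gamma>) ^ d)"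
    using l \<gamma> by (intro divide_ennreal prod_nonneg) auto
  also have "(\<Prod>j<d. \<gamma> - l j) / (2 * \<gamma>) ^ d = (clip \<gamma> x + \<gamma>) / (2 * \<gamma>)"
    unfolding prod using i \<gamma> by (cases d) (auto simp: field_simps)
  finally show ?thesis
    using \<gamma> by (simp add: measure_def clip_def)
qed

text \<open>The sign is twice the indicator of a half-space minus 1; the half-space is closed
  because \<open>sign1 0 = 1\<close>.\<close>

lemma integral_sign1_uniform_cube:
  assumes i: "i < d" and \<gamma>: "0 < \<gamma>"
  shows "(\<integral>g. sign1 (x + g i) \<partial>uniform_cube d \<gamma>) = clip \<gamma> x / \<gamma>"
proof -
  interpret prob_space "uniform_cube d \<gamma>"
    by (rule prob_space_uniform_cube) fact
  let ?H = "{g \<in> space (vec_space d). - x \<le> g i}"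
  have sp: "space (uniform_cube d \<gamma>) = space (vec_space d)"
    by (rule sets_eq_imp_space_eq) simp
  have H: "?H \<in> events"
    using i by simp
  have "(\<integral>g. sign1 (x + g i) \<partial>uniform_cube d \<gamma>) = (\<integral>g. 2 * indicator ?H g - 1 \<partial>uniform_cube d \<gamma>)"
    by (intro Bochner_Integration.integral_cong) (auto simp: sign1_def indicator_def sp)
  also have "\<dots> = 2 * prob ?H - 1"
    using H by (subst Bochner_Integration.integral_diff) (auto simp: prob_space emeasure_eq_measure)
  finally show ?thesis
    using \<gamma> unfolding measure_uniform_cube_halfspace[OF assms] by (simp add: field_simps)
qed

section \<open>Merging independent families and integrating out one variable\<close>

text \<open>A rectangle over the disjoint sum of the index sets is the intersection of a rectangle
  over \<open>I\<close> and one over \<open>J\<close>. Independence of the two families splits its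
  probability, and independence inside each family splits the two factors.\<close>

lemma (in prob_space) indep_vars_Plus:
  assumes fin: "finite I" "finite J"
    and X: "indep_vars N X I" and Y: "indep_vars L Y J"
    and ind: "indep_set {(\<lambda>\<omega>. \<lambda>i\<in>I. X i \<omega>) -` A \<inter> space M | A. A \<in> sets (PiM I N)}
                        {(\<lambda>\<omega>. \<lambda>j\<in>J. Y j \<omega>) -` B \<inter> space M | B. B \<in> sets (PiM J L)}"
  shows "indep_vars (case_sum N L) (case_sum X Y) (I <+> J)"
proof (cases "I <+> J = {}")
  case False
  let ?N = "case_sum N L" and ?Z = "case_sum X Y"
  have rv: "random_variable (?N i) (?Z i)" if "i \<in> I <+> J" for i
    using that X Y by (auto simp: indep_vars_def)
  have marginal: "prob ((\<lambda>\<omega>. \<lambda>i\<in>I. X i \<omega>) -` (PiE I A) \<inter> space M) = (\<Prod>i\<in>I. prob (X i -` A i \<inter> space M))"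
    if "finite I" and X: "indep_vars N X I" and A: "\<And>i. i \<in> I \<Longrightarrow> A i \<in> sets (N i)"
    for I :: "'k set" and N and X :: "'k \<Rightarrow> 'a \<Rightarrow> 'e" and A
  \<comment> \<open>For empty \<open>I\<close> the event is all of \<open>space M\<close> and the
    product is empty; an intersection over the empty set would not stay inside
    \<open>space M\<close>.\<close>
  proof (cases "I = {}")
    case False
    then have "(\<lambda>\<omega>. \<lambda>i\<in>I. X i \<omega>) -` (PiE I A) \<inter> space M = (\<Inter>i\<in>I. X i -` A i \<inter> space M)"
      by auto
    with False indep_varsD_finite[OF X False \<open>finite I\<close> A] show ?thesis
      by simp
  qed (simp add: prob_space restrict_def vimage_def)
  show ?thesis
  \<comment> \<open>Each sigma-algebra serves as its own generator, so stability under intersection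
    is immediate.\<close>
  proof (subst indep_vars_finite[where E = "\<lambda>i. sets (?N i)"])
    show "\<forall>A\<in>\<Pi> i\<in>I <+> J. sets (?N i). prob (\<Inter>j\<in>I <+> J. ?Z j -` A j \<inter> space M)
        = (\<Prod>j\<in>I <+> J. prob (?Z j -` A j \<inter> space M))"
    proof
      fix A assume A: "A \<in> (\<Pi> i\<in>I <+> J. sets (?N i))"
      let ?U = "(\<lambda>\<omega>. \<lambda>i\<in>I. X i \<omega>) -` (PiE I (A \<circ> Inl)) \<inter> space M"
      let ?V = "(\<lambda>\<omega>. \<lambda>j\<in>J. Y j \<omega>) -` (PiE J (A \<circ> Inr)) \<inter> space M"
      have AI: "(A \<circ> Inl) i \<in> sets (N i)" if "i \<in> I" for i
        using A that by (force simp: Pi_iff)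
      have AJ: "(A \<circ> Inr) j \<in> sets (L j)" if "j \<in> J" for j
        using A that by (force simp: Pi_iff)
      have "(\<Inter>j\<in>I <+> J. ?Z j -` A j \<inter> space M) = ?U \<inter> ?V"
      proof (rule set_eqI)
        fix \<omega>
        have "\<omega> \<in> (\<Inter>j\<in>I <+> J. ?Z j -` A j \<inter> space M)
            \<longleftrightarrow> \<omega> \<in> space M \<and> (\<forall>k\<in>I <+> J. ?Z k \<omega> \<in> A k)"
          using False by blast
        also have "(\<forall>k\<in>I <+> J. ?Z k \<omega> \<in> A k)
            \<longleftrightarrow> (\<forall>i\<in>I. X i \<omega> \<in> A (Inl i)) \<and> (\<forall>j\<in>J. Y j \<omega> \<in> A (Inr j))"
          by (simp add: Plus_def ball_Un)
        finally show "\<omega> \<in> (\<Inter>j\<in>I <+> J. ?Z j -` A j \<inter> space M) \<longleftrightarrow> \<omega> \<in> ?U \<inter> ?V"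
          by (auto simp: PiE_iff)
      qed
      moreover have "prob (?U \<inter> ?V) = prob ?U * prob ?V"
        using fin AI AJ by (intro indep_setD[OF ind]) (auto intro!: exI sets_PiM_I_finite)
      ultimately show "prob (\<Inter>j\<in>I <+> J. ?Z j -` A j \<inter> space M)
          = (\<Prod>j\<in>I <+> J. prob (?Z j -` A j \<inter> space M))"
        using marginal[OF fin(1) X AI] marginal[OF fin(2) Y AJ] fin
        by (simp add: prod.Plus)
    qed
  qed (use False fin rv in \<open>auto simp: sets.sigma_sets_eq sets.Int_stable sets.space_closed\<close>)
qed (auto simp: indep_vars_def indep_sets_def Plus_def)

text \<open>The joint law is the product of the marginals, so \<open>B\<close> can be integrated
  with \<open>A\<close> frozen; boundedness of \<open>f\<close> gives integrability.\<close>

lemma (in prob_space) indep_var_expectation_Fubini: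
  fixes f :: "_ \<Rightarrow> real"
  assumes ind: "indep_var S A T B" and f: "f \<in> borel_measurable (S \<Otimes>\<^sub>M T)"
    and bdd: "\<And>x. \<bar>f x\<bar> \<le> C"
  shows "expectation (\<lambda>\<omega>. f (A \<omega>, B \<omega>)) = expectation (\<lambda>\<omega>. expectation (\<lambda>\<omega>'. f (A \<omega>, B \<omega>')))"
proof -
  note [measurable] = f
  have A [measurable]: "random_variable S A" and B [measurable]: "random_variable T B"
    using ind by (blast dest: indep_var_rv1 indep_var_rv2)+
  interpret A: prob_space "distr M S A"
    by (rule prob_space_distr) fact
  interpret B: prob_space "distr M T B"
    by (rule prob_space_distr) fact
  interpret AB: pair_prob_space "distr M S A" "distr M T B" ..
  have joint: "distr M (S \<Otimes>\<^sub>M T) (\<lambda>\<omega>. (A \<omega>, B \<omega>)) = distr M S A \<Otimes>\<^sub>M distr M T B"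
    using ind unfolding indep_var_distribution_eq by simp
  have f': "f \<in> borel_measurable (distr M S A \<Otimes>\<^sub>M distr M T B)"
    using f by (simp cong: measurable_cong_sets)
  have "expectation (\<lambda>\<omega>. f (A \<omega>, B \<omega>)) = (\<integral>z. f z \<partial>(distr M S A \<Otimes>\<^sub>M distr M T B))"
    unfolding joint[symmetric] using A B f by (subst integral_distr) auto
  also have "\<dots> = (\<integral>a. \<integral>b. f (a, b) \<partial>distr M T B \<partial>distr M S A)"
    using f' bdd by (intro AB.integral_fst'[symmetric] AB.P.integrable_const_bound[of _ C]) auto
  also have "\<dots> = (\<integral>a. expectation (\<lambda>\<omega>'. f (a, B \<omega>')) \<partial>distr M S A)"
    using B f by (intro Bochner_Integration.integral_cong refl integral_distr) auto
  also have "\<dots> = expectation (\<lambda>\<omega>. expectation (\<lambda>\<omega>'. f (A \<omega>, B \<omega>')))"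
    by (rule integral_distr) measurable
  finally show ?thesis .
qed

section \<open>The bias caused by clipping a sub-Gaussian variable\<close>

text \<open>The product of the clipped values has the sign of \<open>x * y\<close> and no larger
  modulus, so the difference is at most the square of the larger of \<open>\<bar>x\<bar>\<close> and
  \<open>\<bar>y\<bar>\<close>. If anything is clipped, the larger one exceeds
  \<open>\<gamma>\<close> and its square is one of the two terms.\<close>

lemma abs_mult_minus_clip:
  assumes "0 < \<gamma>"
  shows "\<bar>x * y - clip \<gamma> x * clip \<gamma> y\<bar> \<le> x\<^sup>2 * of_bool (\<gamma> < \<bar>x\<bar>) + y\<^sup>2 * of_bool (\<gamma> < \<bar>y\<bar>)"
proof -
  have *: "\<bar>x * y - clip \<gamma> x * clip \<gamma> y\<bar> \<le> \<bar>x\<bar> * \<bar>y\<bar>"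
  proof -
    have clip: "\<bar>clip \<gamma> z\<bar> \<le> \<bar>z\<bar>" "0 \<le> clip \<gamma> z * z" for z
      using assms by (auto simp: clip_def max_def min_def zero_le_mult_iff)
    have "\<bar>clip \<gamma> x * clip \<gamma> y\<bar> \<le> \<bar>x * y\<bar>"
      unfolding abs_mult by (intro mult_mono clip) auto
    moreover have "0 \<le> (clip \<gamma> x * clip \<gamma> y) * (x * y)"
      using mult_nonneg_nonneg[OF clip(2)[of x] clip(2)[of y]] by (simp add: mult_ac)
    moreover have "\<bar>b - a\<bar> \<le> \<bar>b\<bar>" if "\<bar>a\<bar> \<le> \<bar>b\<bar>" "0 \<le> a * b" for a b :: real
      using that by (auto simp: zero_le_mult_iff)
    ultimately show ?thesis
      unfolding abs_mult[symmetric] by blast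
  qed
  have sq: "\<bar>x\<bar> * \<bar>y\<bar> \<le> (max \<bar>x\<bar> \<bar>y\<bar>)\<^sup>2"
    unfolding power2_eq_square by (intro mult_mono) auto
  show ?thesis
  proof (cases "\<gamma> < \<bar>x\<bar> \<or> \<gamma> < \<bar>y\<bar>")
    case True
    then have "(max \<bar>x\<bar> \<bar>y\<bar>)\<^sup>2 \<le> x\<^sup>2 * of_bool (\<gamma> < \<bar>x\<bar>) + y\<^sup>2 * of_bool (\<gamma> < \<bar>y\<bar>)"
      by (auto simp: max_def of_bool_def)
    with * sq show ?thesis
      by linarith
  next
    case False
    then have "clip \<gamma> x = x" "clip \<gamma> y = y"
      by (auto simp: clip_def)
    then show ?thesis
      by simp
  qed
qed

text \<open>Half of the exponent \<open>x\<^sup>2 / t\<^sup>2\<close> absorbs the factor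
  \<open>x\<^sup>2\<close>; the other half exceeds \<open>\<gamma>\<^sup>2 / (2 * t\<^sup>2)\<close>
  where the indicator is 1 and yields the decay.\<close>

lemma truncated_square_le:
  fixes x t \<gamma> :: real
  assumes "0 < t" "0 < \<gamma>"
  shows "x\<^sup>2 * of_bool (\<gamma> < \<bar>x\<bar>) \<le> 2 * t\<^sup>2 * exp (- \<gamma>\<^sup>2 / (2 * t\<^sup>2)) * exp (x\<^sup>2 / t\<^sup>2)"
proof (cases "\<gamma> < \<bar>x\<bar>")
  case True
  then have "\<gamma>\<^sup>2 \<le> x\<^sup>2"
    using assms power_mono[of \<gamma> "\<bar>x\<bar>" 2] by simp
  have "x\<^sup>2 = 2 * t\<^sup>2 * (x\<^sup>2 / (2 * t\<^sup>2))"
    using assms by simp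
  also have "\<dots> \<le> 2 * t\<^sup>2 * exp (x\<^sup>2 / (2 * t\<^sup>2))"
    by (intro mult_left_mono order_trans[OF _ exp_ge_add_one_self]) auto
  also have "\<dots> = 2 * t\<^sup>2 * exp (- x\<^sup>2 / (2 * t\<^sup>2) + x\<^sup>2 / t\<^sup>2)"
    by (simp add: field_simps)
  also have "\<dots> \<le> 2 * t\<^sup>2 * exp (- \<gamma>\<^sup>2 / (2 * t\<^sup>2) + x\<^sup>2 / t\<^sup>2)"
  proof -
    have "- x\<^sup>2 / (2 * t\<^sup>2) \<le> - \<gamma>\<^sup>2 / (2 * t\<^sup>2)"
      using \<open>\<gamma>\<^sup>2 \<le> x\<^sup>2\<close> by (intro divide_right_mono) auto
    then show ?thesis
      by (intro mult_left_mono) auto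
  qed
  finally show ?thesis
    using True unfolding exp_add by (simp add: mult_ac)
qed (use assms in simp)

text \<open>The two pointwise bounds are integrated. Each exponential moment is at most 2, so the
  prefactor \<open>2 * t\<^sup>2\<close> becomes \<open>8 * t\<^sup>2\<close>.\<close>

lemma (in prob_space) truncation_bias:
  assumes [measurable]: "Y \<in> borel_measurable M" "Z \<in> borel_measurable M"
    and t: "0 < t" and \<gamma>: "0 < \<gamma>"
    and Y: "(\<integral>\<^sup>+ \<omega>. ennreal (exp ((Y \<omega>)\<^sup>2 / t\<^sup>2)) \<partial>M) \<le> 2"
    and Z: "(\<integral>\<^sup>+ \<omega>. ennreal (exp ((Z \<omega>)\<^sup>2 / t\<^sup>2)) \<partial>M) \<le> 2"
  shows "\<bar>expectation (\<lambda>\<omega>. clip \<gamma> (Y \<omega>) * clip \<gamma> (Z \<omega>)) - expectation (\<lambda>\<omega>. Y \<omega> * Z \<omega>)\<bar>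
    \<le> 8 * t\<^sup>2 * exp (- \<gamma>\<^sup>2 / (2 * t\<^sup>2))"
proof -
  define e where "e = 2 * t\<^sup>2 * exp (- \<gamma>\<^sup>2 / (2 * t\<^sup>2))"
  have exp_int: "integrable M (\<lambda>\<omega>. exp ((V \<omega>)\<^sup>2 / t\<^sup>2))"
    and exp_le: "expectation (\<lambda>\<omega>. exp ((V \<omega>)\<^sup>2 / t\<^sup>2)) \<le> 2"
    if [measurable]: "V \<in> borel_measurable M"
      and V: "(\<integral>\<^sup>+ \<omega>. ennreal (exp ((V \<omega>)\<^sup>2 / t\<^sup>2)) \<partial>M) \<le> 2" for V
  proof -
    show int: "integrable M (\<lambda>\<omega>. exp ((V \<omega>)\<^sup>2 / t\<^sup>2))"
    proof (rule integrableI_nonneg)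
      show "(\<integral>\<^sup>+ \<omega>. ennreal (exp ((V \<omega>)\<^sup>2 / t\<^sup>2)) \<partial>M) < \<infinity>"
        by (rule le_less_trans[OF V]) simp
    qed auto
    have "ennreal (expectation (\<lambda>\<omega>. exp ((V \<omega>)\<^sup>2 / t\<^sup>2))) \<le> ennreal 2"
      using V by (subst nn_integral_eq_integral[symmetric, OF int]) auto
    then show "expectation (\<lambda>\<omega>. exp ((V \<omega>)\<^sup>2 / t\<^sup>2)) \<le> 2"
      by (subst (asm) ennreal_le_iff) auto
  qed
  note int = exp_int[OF assms(1) Y] exp_int[OF assms(2) Z]
  have YZ: "integrable M (\<lambda>\<omega>. Y \<omega> * Z \<omega>)"
  proof (rule Bochner_Integration.integrable_bound)
    show "integrable M (\<lambda>\<omega>. t\<^sup>2 * (exp ((Y \<omega>)\<^sup>2 / t\<^sup>2) + exp ((Z \<omega>)\<^sup>2 / t\<^sup>2)))"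
      using int by simp
    have "\<bar>y * z\<bar> \<le> t\<^sup>2 * (exp (y\<^sup>2 / t\<^sup>2) + exp (z\<^sup>2 / t\<^sup>2))" for y z :: real
    proof -
      have sq: "v\<^sup>2 \<le> t\<^sup>2 * exp (v\<^sup>2 / t\<^sup>2)" for v :: real
      proof -
        have "v\<^sup>2 / t\<^sup>2 \<le> exp (v\<^sup>2 / t\<^sup>2)"
          using exp_ge_add_one_self[of "v\<^sup>2 / t\<^sup>2"] by linarith
        then show ?thesis
          using t by (subst (asm) pos_divide_le_eq) (auto simp: mult.commute)
      qed
      have "0 \<le> (\<bar>y\<bar> - \<bar>z\<bar>)\<^sup>2"
        by simp
      then have "2 * \<bar>y * z\<bar> \<le> y\<^sup>2 + z\<^sup>2"
        by (simp add: power2_diff abs_mult)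
      with sq[of y] sq[of z] show ?thesis
        by (simp add: distrib_left)
    qed
    then show "AE \<omega> in M. norm (Y \<omega> * Z \<omega>)
        \<le> norm (t\<^sup>2 * (exp ((Y \<omega>)\<^sup>2 / t\<^sup>2) + exp ((Z \<omega>)\<^sup>2 / t\<^sup>2)))"
      by (auto simp: abs_mult intro: order_trans[OF _ abs_ge_self])
  qed simp
  have clip_bound: "\<bar>clip \<gamma> x\<bar> \<le> \<gamma>" for x
    using \<gamma> by (auto simp: clip_def)
  have cYZ: "integrable M (\<lambda>\<omega>. clip \<gamma> (Y \<omega>) * clip \<gamma> (Z \<omega>))"
    using mult_mono[OF clip_bound clip_bound] \<gamma>
    by (intro integrable_const_bound[of _ "\<gamma> * \<gamma>"]) (auto simp: abs_mult)
  have "\<bar>expectation (\<lambda>\<omega>. clip \<gamma> (Y \<omega>) * clip \<gamma> (Z \<omega>)) - expectation (\<lambda>\<omega>. Y \<omega> * Z \<omega>)\<bar>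
      = \<bar>expectation (\<lambda>\<omega>. clip \<gamma> (Y \<omega>) * clip \<gamma> (Z \<omega>) - Y \<omega> * Z \<omega>)\<bar>"
    by (subst Bochner_Integration.integral_diff[OF cYZ YZ]) simp
  also have "\<dots> \<le> expectation (\<lambda>\<omega>. \<bar>clip \<gamma> (Y \<omega>) * clip \<gamma> (Z \<omega>) - Y \<omega> * Z \<omega>\<bar>)"
    by (rule integral_abs_bound)
  also have "\<dots> \<le> expectation (\<lambda>\<omega>. e * exp ((Y \<omega>)\<^sup>2 / t\<^sup>2) + e * exp ((Z \<omega>)\<^sup>2 / t\<^sup>2))"
  proof (rule integral_mono)
    fix \<omega>
    show "\<bar>clip \<gamma> (Y \<omega>) * clip \<gamma> (Z \<omega>) - Y \<omega> * Z \<omega>\<bar> \<le> e * exp ((Y \<omega>)\<^sup>2 / t\<^sup>2) + e * exp ((Z \<omega>)\<^sup>2 / t\<^sup>2)"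
      using abs_mult_minus_clip[OF \<gamma>, of "Y \<omega>" "Z \<omega>"] truncated_square_le[OF t \<gamma>, of "Y \<omega>"]
        truncated_square_le[OF t \<gamma>, of "Z \<omega>"] unfolding e_def by linarith
  qed (use cYZ YZ int in auto)
  also have "\<dots> = e * expectation (\<lambda>\<omega>. exp ((Y \<omega>)\<^sup>2 / t\<^sup>2)) + e * expectation (\<lambda>\<omega>. exp ((Z \<omega>)\<^sup>2 / t\<^sup>2))"
    using int by simp
  also have "\<dots> \<le> e * 2 + e * 2"
    using exp_le[OF assms(1) Y] exp_le[OF assms(2) Z]
    by (intro add_mono mult_left_mono) (auto simp: e_def)
  finally show ?thesis
    by (simp add: e_def)
qed

text \<open>An infimum need not be attained a priori, so the moment bound is drawn at
  \<open>t\<close> strictly above \<open>\<sigma>\<close>: some admissible \<open>s\<close> lies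
  below \<open>t\<close>, and the integrand decreases in the scale.\<close>

lemma psi2_norm_leD:
  assumes "psi2_norm M Z \<le> ennreal \<sigma>" "0 < \<sigma>" "\<sigma> < t"
  shows "(\<integral>\<^sup>+ \<omega>. ennreal (exp ((Z \<omega>)\<^sup>2 / t\<^sup>2)) \<partial>M) \<le> 2"
proof -
  have "psi2_norm M Z < ennreal t"
    using assms by (simp add: ennreal_lessI le_less_trans)
  then obtain s where s: "ennreal s < ennreal t" "0 < s"
    and le: "(\<integral>\<^sup>+ \<omega>. ennreal (exp ((Z \<omega>)\<^sup>2 / s\<^sup>2)) \<partial>M) \<le> 2"
    unfolding psi2_norm_def Inf_less_iff by auto
  then have "s\<^sup>2 \<le> t\<^sup>2"
    using assms by (intro power_mono) (auto simp: ennreal_less_iff)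
  then have "(\<integral>\<^sup>+ \<omega>. ennreal (exp ((Z \<omega>)\<^sup>2 / t\<^sup>2)) \<partial>M) \<le> (\<integral>\<^sup>+ \<omega>. ennreal (exp ((Z \<omega>)\<^sup>2 / s\<^sup>2)) \<partial>M)"
    using s assms(2,3) by (intro nn_integral_mono ennreal_leI) (simp add: divide_left_mono)
  with le show ?thesis
    by (rule order_trans[rotated])
qed

subsection \<open>Concentration of the one-bit covariance\<close>

locale dithered_sample = prob_space M for M :: "'w measure" +
  fixes d n :: nat and \<sigma> \<gamma> :: real
    and X :: "nat \<Rightarrow> 'w \<Rightarrow> nat \<Rightarrow> real" and \<Gamma> :: "nat \<Rightarrow> nat \<Rightarrow> 'w \<Rightarrow> nat \<Rightarrow> real"
  assumes sample: "iid_sample M d n X"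
    and subgaussian: "\<And>k i. k < n \<Longrightarrow> i < d \<Longrightarrow> psi2_norm M (\<lambda>\<omega>. X k \<omega> i) \<le> ennreal \<sigma>"
    and dithers: "uniform_dithers M d n \<gamma> \<Gamma>"
    and dithers_sample: "dithers_indep_sample M d n X \<Gamma>"
    and \<sigma>_pos: "0 < \<sigma>" and \<gamma>_pos: "0 < \<gamma>" and n_pos: "0 < n"
begin

abbreviation cov :: "nat \<Rightarrow> nat \<Rightarrow> real" where
  "cov \<equiv> second_moment M (X 0)"

lemma X_rv: "k < n \<Longrightarrow> random_variable (vec_space d) (X k)"
  using sample by (auto simp: iid_sample_def indep_vars_def)

lemma \<Gamma>_rv: "k < n \<Longrightarrow> a \<in> {1, 2} \<Longrightarrow> random_variable (vec_space d) (\<Gamma> k a)"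
  using dithers by (force simp: uniform_dithers_def indep_vars_def)

lemma X_component [measurable]: "k < n \<Longrightarrow> i < d \<Longrightarrow> (\<lambda>\<omega>. X k \<omega> i) \<in> borel_measurable M"
  using measurable_compose[OF X_rv vec_space_component] .

lemma \<Gamma>_component: "k < n \<Longrightarrow> a \<in> {1, 2} \<Longrightarrow> i < d \<Longrightarrow> (\<lambda>\<omega>. \<Gamma> k a \<omega> i) \<in> borel_measurable M"
  using measurable_compose[OF \<Gamma>_rv vec_space_component] .

lemma one_bit_measurable:
  assumes "k < n" "a \<in> {1, 2}" "i < d"
  shows "(\<lambda>\<omega>. one_bit X \<Gamma> k a \<omega> i) \<in> borel_measurable M"
proof -
  note [measurable] = X_component[OF assms(1,3)] \<Gamma>_component[OF assms]
  show ?thesis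
    unfolding one_bit_def by measurable
qed

lemma one_bit_cov_measurable:
  assumes "i < d" "j < d"
  shows "(\<lambda>\<omega>. one_bit_cov n \<gamma> X \<Gamma> \<omega> i j) \<in> borel_measurable M"
  unfolding one_bit_cov_def using assms
  by (intro borel_measurable_times borel_measurable_sum borel_measurable_add one_bit_measurable) auto

text \<open>
  The operator norm is a supremum over an uncountable set; the error is measurable because it is a
  function of finitely many bits.
\<close>

lemma estimation_error_measurable: "estimation_error M d n \<gamma> \<zeta> X \<Gamma> \<in> borel_measurable M"
proof -
  let ?I = "{..<n} \<times> {1, 2 :: nat} \<times> {..<d}"
  define bits where "bits \<omega> = (\<lambda>p\<in>?I. case p of (k, a, i) \<Rightarrow> one_bit X \<Gamma> k a \<omega> i)" for \<omega>
  define F where "F z = op_norm d (\<lambda>i j. hard_threshold \<zeta> (\<gamma>\<^sup>2 / (2 * real n) *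
      (\<Sum>k<n. z (k, 1, i) * z (k, 2, j) + z (k, 2, i) * z (k, 1, j))) - cov i j)"
    for z :: "nat \<times> nat \<times> nat \<Rightarrow> real"
  have "bits \<in> measurable M (PiM ?I (\<lambda>_. count_space {- 1, 1}))"
    unfolding bits_def
  proof (rule measurable_restrict)
    fix p assume "p \<in> ?I"
    then obtain k a i where p: "p = (k, a, i)" "k < n" "a \<in> {1, 2}" "i < d"
      by auto
    have "(\<lambda>\<omega>. one_bit X \<Gamma> k a \<omega> i) -` {c} \<inter> space M \<in> events" for c
      by (rule measurable_sets[OF one_bit_measurable[OF p(2-4)]]) simp
    then show "(\<lambda>\<omega>. case p of (k, a, i) \<Rightarrow> one_bit X \<Gamma> k a \<omega> i) \<in> measurable M (count_space {- 1, 1})"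
      using p by (subst measurable_count_space_eq2) (auto simp: one_bit_def sign1_def)
  qed
  \<comment> \<open>A finite product of finite discrete spaces is discrete, so every
    \<open>F\<close> on it is measurable.\<close>
  also have "PiM ?I (\<lambda>_. count_space {- 1, 1 :: real}) = count_space (PiE ?I (\<lambda>_. {- 1, 1}))"
    by (rule count_space_PiM_finite) auto
  finally have "(\<lambda>\<omega>. F (bits \<omega>)) \<in> borel_measurable M"
    by (rule measurable_compose) simp
  moreover have "estimation_error M d n \<gamma> \<zeta> X \<Gamma> = (\<lambda>\<omega>. F (bits \<omega>))"
    unfolding estimation_error_def F_def one_bit_cov_def
    by (intro ext op_norm_cong arg_cong2[where f = "(-)"] arg_cong2[where f = hard_threshold]
        arg_cong2[where f = "(*)"] sum.cong refl) (simp add: bits_def)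
  ultimately show ?thesis
    by simp
qed

lemma estimation_error_nonneg: "0 \<le> estimation_error M d n \<gamma> \<zeta> X \<Gamma> \<omega>"
  unfolding estimation_error_def by (rule op_norm_nonneg)

text \<open>Samples and dithers become one family over a sum type, so that any grouping of them is a
  choice of disjoint index subsets.\<close>

lemma joint_indep:
  "indep_vars (\<lambda>_. vec_space d) (case_sum X (\<lambda>(k, a). \<Gamma> k a)) ({..<n} <+> {..<n} \<times> {1, 2})"
proof -
  have eq: "(\<lambda>\<omega>. \<lambda>(k, a)\<in>{..<n} \<times> {1, 2}. \<Gamma> k a \<omega>)
      = (\<lambda>\<omega>. \<lambda>p\<in>{..<n} \<times> {1, 2}. (case p of (k, a) \<Rightarrow> \<Gamma> k a) \<omega>)"
    by (auto simp: fun_eq_iff restrict_def)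
  have "indep_vars (case_sum (\<lambda>_. vec_space d) (\<lambda>_. vec_space d)) (case_sum X (\<lambda>(k, a). \<Gamma> k a))
      ({..<n} <+> {..<n} \<times> {1, 2})"
    using sample dithers dithers_sample unfolding dithers_indep_sample_def eq
    by (intro indep_vars_Plus) (auto simp: iid_sample_def uniform_dithers_def)
  also have "case_sum (\<lambda>_. vec_space d) (\<lambda>_. vec_space d) = (\<lambda>_ :: nat + nat \<times> nat. vec_space d)"
    by (auto split: sum.split)
  finally show ?thesis .
qed

lemma joint_component:
  assumes "p \<in> P" "i < d"
  shows "(\<lambda>z. z p i) \<in> borel_measurable (PiM P (\<lambda>_. vec_space d))"
  using measurable_compose[OF measurable_component_singleton[OF assms(1)] vec_space_component[OF assms(2)]] .

text \<open>The \<open>k\<close>-th summand is a function of sample \<open>k\<close> and its two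
  dithers, and these index triples are disjoint for different \<open>k\<close>.\<close>

lemma summands_indep:
  assumes "i < d" "j < d"
  shows "indep_vars (\<lambda>_. borel) (\<lambda>k \<omega>. one_bit X \<Gamma> k 1 \<omega> i * one_bit X \<Gamma> k 2 \<omega> j
            + one_bit X \<Gamma> k 2 \<omega> i * one_bit X \<Gamma> k 1 \<omega> j) {..<n}"
proof -
  let ?Z = "case_sum X (\<lambda>(k, a). \<Gamma> k a)"
  let ?P = "\<lambda>k. {Inl k, Inr (k, 1), Inr (k, 2)} :: (nat + nat \<times> nat) set"
  let ?s = "\<lambda>z k a i. sign1 (z (Inl k) i + z (Inr (k, a)) i)"
  have "indep_vars (\<lambda>k. PiM (?P k) (\<lambda>_. vec_space d)) (\<lambda>k \<omega>. restrict (\<lambda>p. ?Z p \<omega>) (?P k)) {..<n}"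
    by (rule indep_vars_restrict[OF joint_indep]) (auto simp: disjoint_family_on_def)
  then have "indep_vars (\<lambda>_. borel)
      (\<lambda>k \<omega>. (\<lambda>z. ?s z k 1 i * ?s z k 2 j + ?s z k 2 i * ?s z k 1 j) (restrict (\<lambda>p. ?Z p \<omega>) (?P k))) {..<n}"
  proof (rule indep_vars_compose2)
    fix k
    show "(\<lambda>z. ?s z k 1 i * ?s z k 2 j + ?s z k 2 i * ?s z k 1 j)
        \<in> borel_measurable (PiM (?P k) (\<lambda>_. vec_space d))"
      using assms
      by (intro borel_measurable_add borel_measurable_times
          measurable_compose[OF _ borel_measurable_sign1] joint_component) auto
  qed
  then show ?thesis
    by (simp add: one_bit_def)
qed

lemma expectation_dithered_sign:
  assumes "k < n" "a \<in> {1, 2}" "i < d"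
  shows "expectation (\<lambda>\<omega>. sign1 (x + \<Gamma> k a \<omega> i)) = clip \<gamma> x / \<gamma>"
proof -
  have "expectation (\<lambda>\<omega>. sign1 (x + \<Gamma> k a \<omega> i)) = (\<integral>g. sign1 (x + g i) \<partial>distr M (vec_space d) (\<Gamma> k a))"
    using assms \<Gamma>_rv[OF assms(1,2)] by (subst integral_distr) auto
  also have "distr M (vec_space d) (\<Gamma> k a) = uniform_cube d \<gamma>"
    using dithers assms unfolding uniform_dithers_def by blast
  finally show ?thesis
    using integral_sign1_uniform_cube[OF assms(3) \<gamma>_pos] by simp
qed

text \<open>Integrating out the two dithers one after the other turns each sign into a clipped entry.\<close>

lemma expectation_one_bit_mult:
  assumes k: "k < n" and ab: "a \<in> {1, 2}" "b \<in> {1, 2}" "a \<noteq> b" and ij: "i < d" "j < d"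
  shows "expectation (\<lambda>\<omega>. one_bit X \<Gamma> k a \<omega> i * one_bit X \<Gamma> k b \<omega> j)
    = expectation (\<lambda>\<omega>. clip \<gamma> (X k \<omega> i) * clip \<gamma> (X k \<omega> j)) / \<gamma>\<^sup>2"
proof -
  let ?Z = "case_sum X (\<lambda>(k, a). \<Gamma> k a)"
  let ?A = "{Inl k, Inr (k, b)} :: (nat + nat \<times> nat) set"
  let ?B = "{Inr (k, a)} :: (nat + nat \<times> nat) set"
  let ?A' = "{Inl k} :: (nat + nat \<times> nat) set"
  let ?B' = "{Inr (k, b)} :: (nat + nat \<times> nat) set"
  let ?N = "\<lambda>P. PiM P (\<lambda>_. vec_space d)"
  let ?R = "\<lambda>P \<omega>. restrict (\<lambda>p. ?Z p \<omega>) P"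
  \<comment> \<open>First dither \<open>a\<close> is separated from the sample and dither
    \<open>b\<close>; then dither \<open>b\<close> is separated from the sample alone. Below,
    \<open>g\<close> is what remains of \<open>f\<close> after dither \<open>a\<close> is integrated
    out.\<close>
  have ind: "indep_var (?N ?A) (?R ?A) (?N ?B) (?R ?B)" "indep_var (?N ?A') (?R ?A') (?N ?B') (?R ?B')"
    by (rule indep_var_restrict[OF joint_indep]; use k ab in auto)+
  have clip_le: "\<bar>clip \<gamma> x / \<gamma>\<bar> \<le> 1" for x
    using \<gamma>_pos by (simp add: clip_def abs_le_iff)
  define f where "f x = sign1 (fst x (Inl k) i + snd x (Inr (k, a)) i) * sign1 (fst x (Inl k) j + fst x (Inr (k, b)) j)"
    for x :: "(nat + nat \<times> nat \<Rightarrow> nat \<Rightarrow> real) \<times> (nat + nat \<times> nat \<Rightarrow> nat \<Rightarrow> real)"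
  define g where "g x = clip \<gamma> (fst x (Inl k) i) / \<gamma> * sign1 (fst x (Inl k) j + snd x (Inr (k, b)) j)"
    for x :: "(nat + nat \<times> nat \<Rightarrow> nat \<Rightarrow> real) \<times> (nat + nat \<times> nat \<Rightarrow> nat \<Rightarrow> real)"
  have comp: "(\<lambda>x. fst x p l) \<in> borel_measurable (?N P \<Otimes>\<^sub>M ?N Q)"
      "q \<in> Q \<Longrightarrow> (\<lambda>x. snd x q l) \<in> borel_measurable (?N P \<Otimes>\<^sub>M ?N Q)"
    if "p \<in> P" "l < d" for p q l P Q
    using measurable_compose[OF measurable_fst joint_component[OF that]]
      measurable_compose[OF measurable_snd joint_component[of q Q l]] that by auto
  have f: "f \<in> borel_measurable (?N ?A \<Otimes>\<^sub>M ?N ?B)"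
    unfolding f_def using ij
    by (intro borel_measurable_add borel_measurable_times
        measurable_compose[OF _ borel_measurable_sign1] comp[of "Inl k"] comp(1)) auto
  have g: "g \<in> borel_measurable (?N ?A' \<Otimes>\<^sub>M ?N ?B')"
    unfolding g_def using ij
    by (intro borel_measurable_add borel_measurable_times borel_measurable_divide borel_measurable_const
        measurable_compose[OF _ borel_measurable_sign1] measurable_compose[OF _ borel_measurable_clip]
        comp[of "Inl k"] comp(1)) auto
  have g_le: "\<bar>g x\<bar> \<le> 1" for x
    using clip_le[of "fst x (Inl k) i"] by (simp add: g_def abs_mult)
  have "expectation (\<lambda>\<omega>. one_bit X \<Gamma> k a \<omega> i * one_bit X \<Gamma> k b \<omega> j)
      = expectation (\<lambda>\<omega>. f (?R ?A \<omega>, ?R ?B \<omega>))"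
    by (simp add: f_def one_bit_def)
  also have "\<dots> = expectation (\<lambda>\<omega>. expectation (\<lambda>\<omega>'. f (?R ?A \<omega>, ?R ?B \<omega>')))"
    by (rule indep_var_expectation_Fubini[OF ind(1) f, of 1]) (auto simp: f_def abs_mult)
  also have "\<dots> = expectation (\<lambda>\<omega>. g (?R ?A' \<omega>, ?R ?B' \<omega>))"
    using expectation_dithered_sign[OF k ab(1) ij(1)] by (simp add: f_def g_def)
  also have "\<dots> = expectation (\<lambda>\<omega>. expectation (\<lambda>\<omega>'. g (?R ?A' \<omega>, ?R ?B' \<omega>')))"
    by (rule indep_var_expectation_Fubini[OF ind(2) g g_le])
  also have "\<dots> = expectation (\<lambda>\<omega>. clip \<gamma> (X k \<omega> i) / \<gamma> * (clip \<gamma> (X k \<omega> j) / \<gamma>))"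
    using expectation_dithered_sign[OF k ab(2) ij(2)] by (simp add: g_def)
  finally show ?thesis
    by (simp add: power2_eq_square)
qed

lemma second_moment_eq:
  assumes "k < n" "i < d" "j < d"
  shows "expectation (\<lambda>\<omega>. X k \<omega> i * X k \<omega> j) = cov i j"
proof -
  have moment: "expectation (\<lambda>\<omega>. X k \<omega> i * X k \<omega> j) = (\<integral>x. x i * x j \<partial>distr M (vec_space d) (X k))"
    if "k < n" for k
    using assms X_rv[OF that] by (subst integral_distr) auto
  have "distr M (vec_space d) (X k) = distr M (vec_space d) (X 0)"
    using sample assms unfolding iid_sample_def by blast
  then show ?thesis
    unfolding second_moment_def moment[OF assms(1)] moment[OF n_pos] by simp
qed

text \<open>The mean is the average of the clipped second moments, since the factor
  \<open>\<gamma>\<^sup>2\<close> cancels. Then \<open>truncation_bias\<close> is applied with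
  \<open>t = 2 * \<sigma>\<close>, which turns 8 into 32 and the exponent's 2 into 8.\<close>

lemma one_bit_cov_bias:
  assumes ij: "i < d" "j < d"
  shows "\<bar>expectation (\<lambda>\<omega>. one_bit_cov n \<gamma> X \<Gamma> \<omega> i j) - cov i j\<bar> \<le> 32 * \<sigma>\<^sup>2 * exp (- \<gamma>\<^sup>2 / (8 * \<sigma>\<^sup>2))"
proof -
  let ?\<beta> = "32 * \<sigma>\<^sup>2 * exp (- \<gamma>\<^sup>2 / (8 * \<sigma>\<^sup>2))"
  let ?c = "\<lambda>k. expectation (\<lambda>\<omega>. clip \<gamma> (X k \<omega> i) * clip \<gamma> (X k \<omega> j))"
  have int: "integrable M (\<lambda>\<omega>. one_bit X \<Gamma> k a \<omega> i * one_bit X \<Gamma> k b \<omega> j)"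
    if "k < n" "a \<in> {1, 2}" "b \<in> {1, 2}" for k a b
    using that ij
    by (intro integrable_const_bound[of _ 1] borel_measurable_times one_bit_measurable)
      (auto simp: one_bit_def abs_mult)
  have "expectation (\<lambda>\<omega>. one_bit_cov n \<gamma> X \<Gamma> \<omega> i j) = \<gamma>\<^sup>2 / (2 * real n) * (\<Sum>k<n. ?c k / \<gamma>\<^sup>2 + ?c k / \<gamma>\<^sup>2)"
    unfolding one_bit_cov_def using int ij by (simp add: expectation_one_bit_mult)
  also have "\<dots> = (\<Sum>k<n. ?c k) / real n"
  proof -
    have "(\<Sum>k<n. ?c k / \<gamma>\<^sup>2 + ?c k / \<gamma>\<^sup>2) = 2 * (\<Sum>k<n. ?c k) / \<gamma>\<^sup>2"
      by (simp add: sum_distrib_left sum_divide_distrib)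
    then show ?thesis
      using \<gamma>_pos by simp
  qed
  finally have "expectation (\<lambda>\<omega>. one_bit_cov n \<gamma> X \<Gamma> \<omega> i j) - cov i j = (\<Sum>k<n. ?c k - cov i j) / real n"
    using n_pos by (simp add: sum_subtractf field_simps)
  also have "\<bar>\<dots>\<bar> \<le> (\<Sum>k<n. \<bar>?c k - cov i j\<bar>) / real n"
    by (simp add: divide_right_mono sum_abs)
  also have "\<dots> \<le> (\<Sum>k<n. ?\<beta>) / real n"
  proof (intro divide_right_mono sum_mono)
    fix k assume "k \<in> {..<n}"
    then have k: "k < n"
      by simp
    have psi: "(\<integral>\<^sup>+ \<omega>. ennreal (exp ((X k \<omega> i)\<^sup>2 / (2 * \<sigma>)\<^sup>2)) \<partial>M) \<le> 2" if "i < d" for i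
      using subgaussian[OF k that] \<sigma>_pos by (intro psi2_norm_leD[of _ _ \<sigma>]) auto
    have "\<bar>?c k - expectation (\<lambda>\<omega>. X k \<omega> i * X k \<omega> j)\<bar>
        \<le> 8 * (2 * \<sigma>)\<^sup>2 * exp (- \<gamma>\<^sup>2 / (2 * (2 * \<sigma>)\<^sup>2))"
      using k ij \<sigma>_pos \<gamma>_pos by (intro truncation_bias psi X_component) auto
    then show "\<bar>?c k - cov i j\<bar> \<le> ?\<beta>"
      unfolding second_moment_eq[OF k ij] by (simp add: power_mult_distrib)
  qed simp
  also have "\<dots> = ?\<beta>"
    using n_pos by simp
  finally show ?thesis .
qed

text \<open>As \<open>t\<close> is at least twice the bias, an error above \<open>t\<close> forces a
  deviation of at least \<open>t / 2\<close> from the mean. Hoeffding's inequality applies to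
  summands in an interval of length 4.\<close>

lemma one_bit_cov_tail:
  assumes ij: "i < d" "j < d"
    and t: "64 * \<sigma>\<^sup>2 * exp (- \<gamma>\<^sup>2 / (8 * \<sigma>\<^sup>2)) \<le> t"
  shows "prob {\<omega> \<in> space M. t < \<bar>one_bit_cov n \<gamma> X \<Gamma> \<omega> i j - cov i j\<bar>}
    \<le> 2 * exp (- (real n * t\<^sup>2 / (8 * \<gamma> ^ 4)))"
proof -
  define Y where "Y k \<omega> = one_bit X \<Gamma> k 1 \<omega> i * one_bit X \<Gamma> k 2 \<omega> j
    + one_bit X \<Gamma> k 2 \<omega> i * one_bit X \<Gamma> k 1 \<omega> j" for k \<omega>
  have bit: "one_bit X \<Gamma> k a \<omega> i = 1 \<or> one_bit X \<Gamma> k a \<omega> i = - 1" for k a \<omega> i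
    by (simp add: one_bit_def sign1_def)
  have Y_bound: "Y k \<omega> \<in> {- 2..2}" for k \<omega>
    unfolding Y_def using bit[of k 1 \<omega> i] bit[of k 2 \<omega> j] bit[of k 2 \<omega> i] bit[of k 1 \<omega> j] by auto
  interpret Y: Hoeffding_ineq M "{..<n}" Y "\<lambda>_. - 2" "\<lambda>_. 2" "\<Sum>k<n. expectation (Y k)"
  proof unfold_locales
    show "indep_vars (\<lambda>_. borel) Y {..<n}"
      using summands_indep[OF ij] unfolding Y_def .
  qed (use Y_bound in auto)
  define \<mu> where "\<mu> = (\<Sum>k<n. expectation (Y k))"
  have cov_Y: "one_bit_cov n \<gamma> X \<Gamma> \<omega> i j = \<gamma>\<^sup>2 / (2 * real n) * (\<Sum>k<n. Y k \<omega>)" for \<omega>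
    by (simp add: one_bit_cov_def Y_def)
  have int: "integrable M (Y k)" if "k < n" for k
    using Y.bounded_random_variable[of k] that
    by (auto intro: interval_bounded_random_variable.integrable)
  have mean: "expectation (\<lambda>\<omega>. one_bit_cov n \<gamma> X \<Gamma> \<omega> i j) = \<gamma>\<^sup>2 / (2 * real n) * \<mu>"
    using int by (simp add: cov_Y \<mu>_def)
  have "0 \<le> t"
    using t by (rule order_trans[rotated]) simp
  \<comment> \<open>The deviation \<open>t / 2\<close> divided by the normalization
    \<open>\<gamma>\<^sup>2 / (2 * real n)\<close> of the sum.\<close>
  define \<epsilon> where "\<epsilon> = real n * t / \<gamma>\<^sup>2"
  have "{\<omega> \<in> space M. t < \<bar>one_bit_cov n \<gamma> X \<Gamma> \<omega> i j - cov i j\<bar>}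
      \<subseteq> {\<omega> \<in> space M. \<epsilon> \<le> \<bar>(\<Sum>k<n. Y k \<omega>) - \<mu>\<bar>}"
  proof safe
    fix \<omega> assume "t < \<bar>one_bit_cov n \<gamma> X \<Gamma> \<omega> i j - cov i j\<bar>"
    then have "t / 2 \<le> \<bar>one_bit_cov n \<gamma> X \<Gamma> \<omega> i j - \<gamma>\<^sup>2 / (2 * real n) * \<mu>\<bar>"
      using one_bit_cov_bias[OF ij] t unfolding mean by linarith
    also have "\<dots> = \<gamma>\<^sup>2 / (2 * real n) * \<bar>(\<Sum>k<n. Y k \<omega>) - \<mu>\<bar>"
      unfolding cov_Y right_diff_distrib[symmetric] abs_mult by simp
    finally show "\<epsilon> \<le> \<bar>(\<Sum>k<n. Y k \<omega>) - \<mu>\<bar>"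
      using n_pos \<gamma>_pos by (simp add: \<epsilon>_def field_simps)
  qed
  moreover have "{\<omega> \<in> space M. \<epsilon> \<le> \<bar>(\<Sum>k<n. Y k \<omega>) - \<mu>\<bar>} \<in> events"
    by measurable
  ultimately have "prob {\<omega> \<in> space M. t < \<bar>one_bit_cov n \<gamma> X \<Gamma> \<omega> i j - cov i j\<bar>}
      \<le> prob {\<omega> \<in> space M. \<epsilon> \<le> \<bar>(\<Sum>k<n. Y k \<omega>) - \<mu>\<bar>}"
    by (rule finite_measure_mono)
  also have "\<dots> \<le> 2 * exp (- 2 * \<epsilon>\<^sup>2 / (\<Sum>k<n. (2 - (- 2))\<^sup>2))"
    unfolding \<mu>_def using \<open>0 \<le> t\<close> n_pos
    by (intro Y.Hoeffding_ineq_abs_ge) (auto simp: \<epsilon>_def)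
  also have "- 2 * \<epsilon>\<^sup>2 / (\<Sum>k<n. (2 - (- 2))\<^sup>2) = - (real n * t\<^sup>2 / (8 * \<gamma> ^ 4))"
    using n_pos \<gamma>_pos by (simp add: \<epsilon>_def field_simps power2_eq_square power4_eq_xxxx)
  finally show ?thesis .
qed

section \<open>Events of large entrywise error\<close>

definition bad :: "real \<Rightarrow> 'w set" where
  "bad t = (\<Union>(i, j)\<in>{..<d} \<times> {..<d}. {\<omega> \<in> space M. t < \<bar>one_bit_cov n \<gamma> X \<Gamma> \<omega> i j - cov i j\<bar>})"

lemma deviation_measurable:
  assumes "i < d" "j < d"
  shows "{\<omega> \<in> space M. t < \<bar>one_bit_cov n \<gamma> X \<Gamma> \<omega> i j - cov i j\<bar>} \<in> events"
proof -
  note [measurable] = one_bit_cov_measurable[OF assms]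
  show ?thesis
    by measurable
qed

lemma bad_measurable: "bad t \<in> events"
  unfolding bad_def using deviation_measurable by (intro sets.finite_UN) auto

lemma prob_bad:
  assumes "64 * \<sigma>\<^sup>2 * exp (- \<gamma>\<^sup>2 / (8 * \<sigma>\<^sup>2)) \<le> t"
  shows "prob (bad t) \<le> 2 * (real d)\<^sup>2 * exp (- (real n * t\<^sup>2 / (8 * \<gamma> ^ 4)))"
proof -
  let ?E = "\<lambda>(i, j). {\<omega> \<in> space M. t < \<bar>one_bit_cov n \<gamma> X \<Gamma> \<omega> i j - cov i j\<bar>}"
  have "prob (bad t) \<le> (\<Sum>p\<in>{..<d} \<times> {..<d}. prob (?E p))"
    unfolding bad_def using deviation_measurable by (intro finite_measure_subadditive_finite) auto
  also have "\<dots> \<le> (\<Sum>p\<in>{..<d} \<times> {..<d}. 2 * exp (- (real n * t\<^sup>2 / (8 * \<gamma> ^ 4))))"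
    using one_bit_cov_tail[OF _ _ assms] by (intro sum_mono) auto
  also have "\<dots> = 2 * (real d)\<^sup>2 * exp (- (real n * t\<^sup>2 / (8 * \<gamma> ^ 4)))"
    by (simp add: power2_eq_square)
  finally show ?thesis .
qed

lemma not_bad_iff:
  assumes "\<omega> \<in> space M"
  shows "\<omega> \<notin> bad t \<longleftrightarrow> (\<forall>i<d. \<forall>j<d. \<bar>one_bit_cov n \<gamma> X \<Gamma> \<omega> i j - cov i j\<bar> \<le> t)"
  using assms by (auto simp: bad_def not_less)

lemma estimation_error_not_bad:
  assumes "\<omega> \<in> space M" "\<omega> \<notin> bad (\<zeta> / 2)" "approx_sparse d q s cov"
    and "0 < \<zeta>" "0 \<le> q" "q < 1" "0 < s"
  shows "estimation_error M d n \<gamma> \<zeta> X \<Gamma> \<omega> \<le> 3/2 * (s * \<zeta> powr (1 - q))"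
  unfolding estimation_error_def
proof (rule op_norm_hard_threshold)
  show "cov i j = cov j i" for i j
    by (simp add: second_moment_def mult.commute)
qed (use assms not_bad_iff in auto)

lemma estimation_error_not_bad_trivial:
  assumes "\<omega> \<in> space M" "\<omega> \<notin> bad D" "0 \<le> \<zeta>" "0 \<le> D"
  shows "estimation_error M d n \<gamma> \<zeta> X \<Gamma> \<omega> \<le> real d * (D + \<zeta>)"
  unfolding estimation_error_def using assms not_bad_iff
  by (intro op_norm_hard_threshold_trivial) auto

text \<open>The sum \<open>V\<close> of all entrywise errors is finite, so high levels are not bad,
  while level 0 is; somewhere a bad level is followed by one that is not.\<close>

lemma level_exists:
  assumes \<omega>: "\<omega> \<in> space M" and \<zeta>: "0 < \<zeta>" and bad: "\<omega> \<in> bad (\<zeta> / 2)"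
  obtains m where "\<omega> \<in> bad (\<zeta> / 2 * Suc m)" "\<omega> \<notin> bad (\<zeta> / 2 * Suc (Suc m))"
proof -
  let ?G = "\<lambda>m. \<omega> \<notin> bad (\<zeta> / 2 * Suc m)"
  define V where "V = (\<Sum>i<d. \<Sum>j<d. \<bar>one_bit_cov n \<gamma> X \<Gamma> \<omega> i j - cov i j\<bar>)"
  obtain m where m: "V / (\<zeta> / 2) \<le> real m"
    using real_arch_simple by blast
  have "\<bar>one_bit_cov n \<gamma> X \<Gamma> \<omega> i j - cov i j\<bar> \<le> \<zeta> / 2 * Suc m" if "i < d" "j < d" for i j
  proof -
    have "\<bar>one_bit_cov n \<gamma> X \<Gamma> \<omega> i j - cov i j\<bar> \<le> (\<Sum>j<d. \<bar>one_bit_cov n \<gamma> X \<Gamma> \<omega> i j - cov i j\<bar>)"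
      using that by (intro member_le_sum[of j _ "\<lambda>j. \<bar>one_bit_cov n \<gamma> X \<Gamma> \<omega> i j - cov i j\<bar>"]) auto
    also have "\<dots> \<le> V"
      unfolding V_def using that
      by (intro member_le_sum[of i _ "\<lambda>i. \<Sum>j<d. \<bar>one_bit_cov n \<gamma> X \<Gamma> \<omega> i j - cov i j\<bar>"])
        (auto intro: sum_nonneg)
    also have "\<dots> \<le> \<zeta> / 2 * Suc m"
      using m \<zeta> by (simp add: field_simps)
    finally show ?thesis .
  qed
  then have "?G m"
    using \<omega> by (simp add: not_bad_iff)
  moreover have "\<not> ?G 0"
    using bad by simp
  ultimately obtain k where "\<not> ?G k" "?G (Suc k)"
    using ex_least_nat_less[of ?G m] \<open>?G m\<close> by blast
  with that show thesis
    by blast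
qed

end

section \<open>A moment bound from a sequence of events\<close>

text \<open>Pointwise, the power of \<open>f\<close> is at most \<open>a powr p\<close> plus the sum
  of \<open>b m powr p\<close> over the events containing the point, which may overlap. The
  geometric weights of the tail bound sum to \<open>C\<close>.\<close>

lemma (in prob_space) moment_le_levels:
  assumes [measurable]: "f \<in> borel_measurable M" "\<And>m. B m \<in> events"
    and nonneg: "\<And>\<omega>. 0 \<le> f \<omega>" and a: "0 \<le> a" and p: "0 < p"
    and cover: "\<And>\<omega>. \<omega> \<in> space M \<Longrightarrow> f \<omega> \<le> a \<or> (\<exists>m. \<omega> \<in> B m \<and> f \<omega> \<le> b m)"
    and tail: "\<And>m. b m powr p * prob (B m) \<le> C * (1 / 2) ^ Suc m"
    and C: "0 \<le> C"
  shows "expectation (\<lambda>\<omega>. f \<omega> powr p) \<le> a powr p + C"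
proof -
  let ?g = "\<lambda>m \<omega>. ennreal (b m powr p) * indicator (B m) \<omega>"
  have member_le: "h m \<le> (\<Sum>k. h k)" for h :: "nat \<Rightarrow> ennreal" and m
    using sum_le_suminf[of h "{m}"] by simp
  have "(\<integral>\<^sup>+\<omega>. ennreal (f \<omega> powr p) \<partial>M) \<le> (\<integral>\<^sup>+\<omega>. ennreal (a powr p) + (\<Sum>m. ?g m \<omega>) \<partial>M)"
  proof (rule nn_integral_mono)
    fix \<omega> assume "\<omega> \<in> space M"
    then consider "f \<omega> \<le> a" | m where "\<omega> \<in> B m" "f \<omega> \<le> b m"
      using cover by blast
    then show "ennreal (f \<omega> powr p) \<le> ennreal (a powr p) + (\<Sum>m. ?g m \<omega>)"
    proof cases
      case 1
      then have "ennreal (f \<omega> powr p) \<le> ennreal (a powr p)"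
        using nonneg p by (intro ennreal_leI powr_mono2) auto
      then show ?thesis
        by (rule order_trans) (simp add: add_increasing2)
    next
      case (2 m)
      then have "ennreal (f \<omega> powr p) \<le> ?g m \<omega>"
        using nonneg p by (auto intro!: ennreal_leI powr_mono2)
      also have "\<dots> \<le> (\<Sum>m. ?g m \<omega>)"
        by (rule member_le)
      finally show ?thesis
        by (rule order_trans) (simp add: add_increasing)
    qed
  qed
  also have "\<dots> = ennreal (a powr p) + (\<Sum>m. ennreal (b m powr p * prob (B m)))"
    by (subst nn_integral_add)
      (auto simp: nn_integral_suminf nn_integral_cmult_indicator emeasure_eq_measure prob_space ennreal_mult)
  also have "(\<Sum>m. ennreal (b m powr p * prob (B m))) \<le> (\<Sum>m. ennreal (C * (1 / 2) ^ Suc m))"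
    by (intro suminf_le ennreal_leI tail) auto
  also have "\<dots> = ennreal C"
  proof (rule suminf_ennreal_eq)
    show "(\<lambda>m. C * (1 / 2) ^ Suc m) sums C"
      using sums_mult[OF power_half_series, of C] by simp
  qed (use C in auto)
  finally have le: "(\<integral>\<^sup>+\<omega>. ennreal (f \<omega> powr p) \<partial>M) \<le> ennreal (a powr p + C)"
    using C by (simp add: ennreal_plus)
  \<comment> \<open>The finite bound just obtained makes the power integrable, so the left side is a
    true moment and not the default 0.\<close>
  have "expectation (\<lambda>\<omega>. f \<omega> powr p) = enn2real (\<integral>\<^sup>+\<omega>. ennreal (f \<omega> powr p) \<partial>M)"
    by (intro integral_eq_nn_integral) auto
  also have "\<dots> \<le> a powr p + C"
    using enn2real_mono[OF le] C by (simp del: ennreal_plus)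
  finally show ?thesis .
qed

subsection \<open>Error bounds\<close>

locale tuned_dithered_sample = dithered_sample +
  fixes \<delta> C1 C2 :: real
  assumes d_ge_2: "2 \<le> d" and \<delta>_ge_4: "4 \<le> \<delta>" and n_large: "2 * \<delta> * ln (real d) < real n"
    and C1_ge: "2 \<le> C1" and C2_ge: "64 * C1\<^sup>2 \<le> C2"
    and \<gamma>_eq: "\<gamma> = C1 * \<sigma> * sqrt (ln (real n / (2 * \<delta> * ln (real d))))"
begin

abbreviation \<nu> :: real where
  "\<nu> \<equiv> noise_level \<sigma> \<delta> d n"

abbreviation \<zeta> :: real where
  "\<zeta> \<equiv> C2 * \<nu>"

abbreviation L :: real where
  "L \<equiv> \<delta> * ln (real d)"

text \<open>Used to trade \<open>\<delta>\<close> for \<open>L\<close>; the constants come from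
  \<open>ln 2\<close> being at least \<open>2/3\<close> and \<open>\<delta>\<close> at least
  4.\<close>

lemma L_ge: "\<delta> \<le> 3/2 * L" "8/3 \<le> L"
proof -
  have "2/3 \<le> ln (2 :: real)"
    by (rule ln2_ge_two_thirds)
  also have "\<dots> \<le> ln (real d)"
    using d_ge_2 by simp
  finally have "\<delta> * (2/3) \<le> L"
    using \<delta>_ge_4 by (intro mult_left_mono) auto
  then show "\<delta> \<le> 3/2 * L" "8/3 \<le> L"
    using \<delta>_ge_4 by linarith+
qed

lemma ln_n_ge_1: "1 \<le> ln (real n)"
proof -
  have "3 < real n"
    using n_large L_ge by linarith
  then have "exp 1 \<le> real n"
    using exp_le by linarith
  then show ?thesis
    using n_pos by (simp add: ln_ge_iff)
qed

lemma C2_ge_256: "256 \<le> C2"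
proof -
  have "2\<^sup>2 \<le> C1\<^sup>2"
    using C1_ge by (intro power_mono) auto
  with C2_ge show ?thesis
    by simp
qed

lemma \<nu>_pos: "0 < \<nu>"
  unfolding noise_level_def using \<sigma>_pos d_ge_2 \<delta>_ge_4 n_pos less_le_trans[OF zero_less_one ln_n_ge_1]
  by (intro mult_pos_pos real_sqrt_gt_zero divide_pos_pos) auto

lemma \<zeta>_pos: "0 < \<zeta>"
  using \<nu>_pos C2_ge_256 by simp

lemma ratio_gt_1: "1 < real n / (2 * L)"
  using n_large L_ge by simp

lemma ln_ratio: "0 < ln (real n / (2 * L))" "ln (real n / (2 * L)) \<le> ln (real n)"
proof -
  show "0 < ln (real n / (2 * L))"
    using ratio_gt_1 by simp
  have "real n / (2 * L) \<le> real n / 1"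
    using L_ge by (intro divide_left_mono) auto
  then show "ln (real n / (2 * L)) \<le> ln (real n)"
    using ratio_gt_1 by simp
qed

lemma \<gamma>_sq: "\<gamma>\<^sup>2 = C1\<^sup>2 * \<sigma>\<^sup>2 * ln (real n / (2 * L))"
  using ln_ratio(1) unfolding \<gamma>_eq by (simp add: power_mult_distrib mult.assoc)

text \<open>With \<open>C1\<close> at least 2 the exponential is at most the root of
  \<open>2 * L / n\<close>, which is of the order of the noise level. The resulting constant 128 is
  at most \<open>C2 / 2\<close>.\<close>

lemma bias_le: "64 * \<sigma>\<^sup>2 * exp (- \<gamma>\<^sup>2 / (8 * \<sigma>\<^sup>2)) \<le> \<zeta> / 2"
proof -
  let ?R = "real n / (2 * L)"
  have "2\<^sup>2 \<le> C1\<^sup>2"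
    using C1_ge by (intro power_mono) auto
  then have "4 * ln ?R \<le> C1\<^sup>2 * ln ?R"
    using ln_ratio(1) by (intro mult_right_mono) auto
  then have "- \<gamma>\<^sup>2 / (8 * \<sigma>\<^sup>2) \<le> - ln ?R / 2"
    using \<sigma>_pos unfolding \<gamma>_sq by simp
  then have "exp (- \<gamma>\<^sup>2 / (8 * \<sigma>\<^sup>2)) \<le> exp (- ln ?R / 2)"
    by simp
  also have "\<dots> = sqrt (1 / ?R)"
  proof (rule real_sqrt_unique[symmetric])
    have "(exp (- ln ?R / 2))\<^sup>2 = exp (- ln ?R)"
      by (simp flip: exp_of_nat_mult)
    also have "\<dots> = 1 / ?R"
      using ratio_gt_1 by (subst exp_minus, subst exp_ln) (auto simp: field_simps)
    finally show "(exp (- ln ?R / 2))\<^sup>2 = 1 / ?R" .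
  qed simp
  also have "\<dots> = sqrt 2 * sqrt (L / n)"
    by (simp flip: real_sqrt_mult)
  also have "\<dots> \<le> 2 * sqrt (L / n)"
    using sqrt2_less_2 L_ge by (intro mult_right_mono) auto
  finally have "64 * \<sigma>\<^sup>2 * exp (- \<gamma>\<^sup>2 / (8 * \<sigma>\<^sup>2)) \<le> 64 * \<sigma>\<^sup>2 * (2 * sqrt (L / n))"
    by (intro mult_left_mono) auto
  also have "\<dots> = 128 * (\<sigma>\<^sup>2 * 1 * sqrt (L / n))"
    by simp
  \<comment> \<open>The factor 1 is replaced by \<open>ln (real n)\<close>, which is at least
    1.\<close>
  also have "\<dots> \<le> 128 * \<nu>"
    unfolding noise_level_def using ln_n_ge_1 L_ge
    by (intro mult_left_mono mult_right_mono) auto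
  also have "\<dots> \<le> C2 / 2 * \<nu>"
    using C2_ge_256 \<nu>_pos by (intro mult_right_mono) auto
  finally show ?thesis
    by simp
qed

text \<open>The logarithm in \<open>\<zeta>\<close> cancels the one in
  \<open>\<gamma>\<^sup>2\<close>. The constants match because \<open>128 * 8 * 4\<close> is the
  square of 64.\<close>

lemma exponent_ge:
  assumes "0 \<le> m"
  shows "128 * L * m\<^sup>2 \<le> real n * (\<zeta> / 2 * m)\<^sup>2 / (8 * \<gamma> ^ 4)"
proof -
  have "\<gamma> ^ 4 = (\<gamma>\<^sup>2)\<^sup>2"
    by simp
  also have "\<dots> \<le> (C1\<^sup>2 * \<sigma>\<^sup>2 * ln (real n))\<^sup>2"
    unfolding \<gamma>_sq using ln_ratio by (intro power_mono mult_left_mono) auto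
  finally have "128 * L * m\<^sup>2 * (8 * \<gamma> ^ 4) \<le> 128 * L * m\<^sup>2 * (8 * (C1\<^sup>2 * \<sigma>\<^sup>2 * ln (real n))\<^sup>2)"
    using L_ge by (intro mult_left_mono) auto
  also have "\<dots> = (64 * C1\<^sup>2)\<^sup>2 * (L * (\<sigma>\<^sup>2 * ln (real n) * m)\<^sup>2 / 4)"
    by (simp add: power_mult_distrib)
  also have "\<dots> \<le> C2\<^sup>2 * (L * (\<sigma>\<^sup>2 * ln (real n) * m)\<^sup>2 / 4)"
    using C2_ge L_ge by (intro mult_right_mono power_mono) auto
  also have "\<dots> = real n * (\<zeta> / 2 * m)\<^sup>2"
    using n_pos L_ge by (simp add: noise_level_def power_mult_distrib power_divide real_sqrt_pow2)
  finally show ?thesis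
    using \<gamma>_pos by (simp add: pos_le_divide_eq)
qed

text \<open>The factor \<open>2 * d\<^sup>2\<close> of the union bound is at most
  \<open>d ^ 3\<close> and thus at most \<open>exp L\<close>. Replacing \<open>m\<^sup>2\<close> by
  \<open>m\<close> keeps the decay geometric in \<open>m\<close>.\<close>

lemma prob_bad_level:
  assumes "1 \<le> m"
  shows "prob (bad (\<zeta> / 2 * m)) \<le> exp (L - 128 * L * m)"
proof -
  have "64 * \<sigma>\<^sup>2 * exp (- \<gamma>\<^sup>2 / (8 * \<sigma>\<^sup>2)) \<le> \<zeta> / 2 * m"
    using bias_le mult_left_mono[OF assms, of "\<zeta> / 2"] \<zeta>_pos by simp
  then have "prob (bad (\<zeta> / 2 * m)) \<le> 2 * (real d)\<^sup>2 * exp (- (real n * (\<zeta> / 2 * m)\<^sup>2 / (8 * \<gamma> ^ 4)))"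
    by (rule prob_bad)
  also have "\<dots> \<le> exp L * exp (- (128 * L * m))"
  proof (intro mult_mono)
    have "2 * (real d)\<^sup>2 \<le> real d ^ 3"
      using d_ge_2 by (simp add: power3_eq_cube power2_eq_square)
    also have "\<dots> = exp (3 * ln (real d))"
      using d_ge_2 exp_of_nat_mult[of 3 "ln (real d)"] by simp
    also have "\<dots> \<le> exp L"
      using \<delta>_ge_4 d_ge_2 by (simp add: mult_right_mono)
    finally show "2 * (real d)\<^sup>2 \<le> exp L" .
    have "m \<le> m\<^sup>2"
      using assms by (simp add: power2_eq_square)
    then have "128 * L * m \<le> 128 * L * m\<^sup>2"
      using L_ge by (intro mult_left_mono) auto
    also have "\<dots> \<le> real n * (\<zeta> / 2 * m)\<^sup>2 / (8 * \<gamma> ^ 4)"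
      using assms by (intro exponent_ge) auto
    finally show "exp (- (real n * (\<zeta> / 2 * m)\<^sup>2 / (8 * \<gamma> ^ 4))) \<le> exp (- (128 * L * m))"
      by simp
  qed auto
  finally show ?thesis
    by (simp add: exp_diff exp_minus field_simps)
qed

lemma threshold_rate_le:
  assumes "0 \<le> q" "q < 1" "0 < s"
  shows "3/2 * (s * \<zeta> powr (1 - q)) \<le> 2 * C2 * (s * \<nu> powr (1 - q))"
proof -
  have "\<zeta> powr (1 - q) = C2 powr (1 - q) * \<nu> powr (1 - q)"
    using C2_ge_256 \<nu>_pos by (intro powr_mult)
  also have "\<dots> \<le> C2 powr 1 * \<nu> powr (1 - q)"
    using C2_ge_256 assms by (intro mult_right_mono powr_mono) auto
  finally have "\<zeta> powr (1 - q) \<le> C2 * \<nu> powr (1 - q)"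
    using C2_ge_256 by simp
  then have "3/2 * (s * \<zeta> powr (1 - q)) \<le> 3/2 * (s * (C2 * \<nu> powr (1 - q)))"
    using assms by (intro mult_left_mono) auto
  also have "\<dots> \<le> 2 * (s * (C2 * \<nu> powr (1 - q)))"
    using assms C2_ge_256 by (intro mult_right_mono) auto
  finally show ?thesis
    by (simp add: mult_ac)
qed

lemma error_high_probability:
  assumes "approx_sparse d q s cov" "0 \<le> q" "q < 1" "0 < s"
  shows "1 - exp (- \<delta>) \<le> prob {\<omega> \<in> space M. estimation_error M d n \<gamma> \<zeta> X \<Gamma> \<omega> \<le> 4 * C2 * (s * \<nu> powr (1 - q))}"
proof -
  \<comment> \<open>The exponent is \<open>- 127 * L\<close>, and \<open>\<delta>\<close> is at most
    \<open>3/2 * L\<close>.\<close>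
  have "exp (L - 128 * L) \<le> exp (- \<delta>)"
    using L_ge by simp
  moreover have "prob (bad (\<zeta> / 2)) \<le> exp (L - 128 * L)"
    using prob_bad_level[of 1] by simp
  ultimately have "1 - exp (- \<delta>) \<le> 1 - prob (bad (\<zeta> / 2))"
    by linarith
  also have "\<dots> = prob (space M - bad (\<zeta> / 2))"
    using bad_measurable by (rule prob_compl[symmetric])
  also have "\<dots> \<le> prob {\<omega> \<in> space M. estimation_error M d n \<gamma> \<zeta> X \<Gamma> \<omega> \<le> 4 * C2 * (s * \<nu> powr (1 - q))}"
  proof (rule finite_measure_mono)
    note [measurable] = estimation_error_measurable
    show "{\<omega> \<in> space M. estimation_error M d n \<gamma> \<zeta> X \<Gamma> \<omega> \<le> 4 * C2 * (s * \<nu> powr (1 - q))} \<in> events"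
      by measurable
    \<comment> \<open>Weakened so that both bounds share the constant \<open>4 * C2\<close>.\<close>
    have "2 * C2 * (s * \<nu> powr (1 - q)) \<le> 4 * C2 * (s * \<nu> powr (1 - q))"
      using C2_ge_256 assms by (intro mult_right_mono) auto
    with threshold_rate_le[OF assms(2-4)]
    have rate: "3/2 * (s * \<zeta> powr (1 - q)) \<le> 4 * C2 * (s * \<nu> powr (1 - q))"
      by (rule order_trans)
    show "space M - bad (\<zeta> / 2)
        \<subseteq> {\<omega> \<in> space M. estimation_error M d n \<gamma> \<zeta> X \<Gamma> \<omega> \<le> 4 * C2 * (s * \<nu> powr (1 - q))}"
      using order_trans[OF estimation_error_not_bad[OF _ _ assms(1) \<zeta>_pos assms(2-4)] rate]
      by blast
  qed
  finally show ?thesis .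
qed

text \<open>
  On the \<open>m\<close>-th level the trivial bound loses a factor \<open>d\<close>, which the probability of the level
  absorbs because \<open>d\<close> to the power \<open>\<delta> / 4\<close> equals \<open>exp (L / 4)\<close>.
\<close>

lemma level_moment_le:
  "(2 * \<zeta> * real d * Suc m) powr (\<delta> / 4) * prob (bad (\<zeta> / 2 * Suc m))
    \<le> (2 * \<zeta>) powr (\<delta> / 4) * (1 / 2) ^ Suc m"
proof -
  let ?m = "real (Suc m)"
  have m: "1 \<le> ?m"
    by simp
  have d_powr: "real d powr (\<delta> / 4) = exp (L / 4)"
    using d_ge_2 by (simp add: powr_def)
  have "ln ?m \<le> ?m"
    using ln_le_minus_one[of ?m] by simp
  then have "\<delta> / 4 * ln ?m \<le> \<delta> / 4 * ?m"
    using \<delta>_ge_4 by (intro mult_left_mono) auto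
  also have "\<dots> \<le> L * ?m"
    using L_ge by (intro mult_right_mono) auto
  finally have m_powr: "?m powr (\<delta> / 4) \<le> exp (L * ?m)"
    by (simp add: powr_def)
  have "L * 1 \<le> L * ?m"
    using L_ge m by (intro mult_left_mono) linarith+
  moreover have "1 * ?m \<le> L * ?m"
    using L_ge m by (intro mult_right_mono) linarith+
  moreover have "ln 2 * ?m \<le> 1 * ?m"
    using ln_2_less_1 m by (intro mult_right_mono) linarith+
  \<comment> \<open>The positive terms add up to at most \<open>9/4 * L * ?m\<close>, and the rest
    of \<open>128 * L * ?m\<close> exceeds \<open>?m\<close>.\<close>
  ultimately have "L / 4 + L * ?m + (L - 128 * (L * ?m)) \<le> - (ln 2 * ?m)"
    using m by linarith
  then have "exp (L / 4 + L * ?m + (L - 128 * L * ?m)) \<le> exp (- (ln 2 * ?m))"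
    by (simp only: exp_le_cancel_iff mult.assoc)
  also have "\<dots> = (1 / 2) ^ Suc m"
    by (simp only: exp_minus exp_of_nat2_mult exp_ln[OF zero_less_numeral] power_inverse inverse_eq_divide[symmetric])
  finally have exp_le: "exp (L / 4) * exp (L * ?m) * exp (L - 128 * L * ?m) \<le> (1 / 2) ^ Suc m"
    by (simp only: exp_add)
  have "(2 * \<zeta> * real d * ?m) powr (\<delta> / 4) * prob (bad (\<zeta> / 2 * ?m))
      = (2 * \<zeta>) powr (\<delta> / 4) * (exp (L / 4) * ?m powr (\<delta> / 4) * prob (bad (\<zeta> / 2 * ?m)))"
    using \<zeta>_pos by (simp add: powr_mult d_powr)
  also have "\<dots> \<le> (2 * \<zeta>) powr (\<delta> / 4) * (exp (L / 4) * exp (L * ?m) * exp (L - 128 * L * ?m))"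
    using m_powr prob_bad_level[OF m] by (intro mult_left_mono mult_mono) auto
  also have "\<dots> \<le> (2 * \<zeta>) powr (\<delta> / 4) * (1 / 2) ^ Suc m"
    by (intro mult_left_mono exp_le) simp
  finally show ?thesis .
qed

text \<open>The bad levels contribute a multiple of the noise level, and \<open>lower\<close> makes
  this at most the rate because \<open>\<nu>\<close> is the product of \<open>\<nu> powr q\<close>
  and \<open>\<nu> powr (1 - q)\<close>.\<close>

lemma error_moment:
  assumes sparse: "approx_sparse d q s cov" and q: "0 \<le> q" "q < 1" and s: "0 < s"
    and lower: "\<nu> powr q \<le> s"
  shows "(\<integral>\<omega>. estimation_error M d n \<gamma> \<zeta> X \<Gamma> \<omega> powr (\<delta> / 4) \<partial>M) powr (1 / (\<delta> / 4))
    \<le> 4 * C2 * (s * \<nu> powr (1 - q))"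
proof -
  let ?p = "\<delta> / 4" and ?r = "2 * C2 * (s * \<nu> powr (1 - q))"
  have r: "0 \<le> ?r"
    using s C2_ge_256 by simp
  have "\<nu> = \<nu> powr q * \<nu> powr (1 - q)"
    using \<nu>_pos by (simp flip: powr_add)
  also have "\<dots> \<le> s * \<nu> powr (1 - q)"
    using lower by (intro mult_right_mono) auto
  finally have "2 * \<zeta> \<le> ?r"
    using C2_ge_256 by simp
  then have \<zeta>_r: "(2 * \<zeta>) powr ?p \<le> ?r powr ?p"
    using \<zeta>_pos \<delta>_ge_4 by (intro powr_mono2) auto
  have "(\<integral>\<omega>. estimation_error M d n \<gamma> \<zeta> X \<Gamma> \<omega> powr ?p \<partial>M) \<le> ?r powr ?p + (2 * \<zeta>) powr ?p"
  proof (rule moment_le_levels[where B = "\<lambda>m. bad (\<zeta> / 2 * Suc m)" and b = "\<lambda>m. 2 * \<zeta> * real d * Suc m"])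
    fix \<omega> assume \<omega>: "\<omega> \<in> space M"
    show "estimation_error M d n \<gamma> \<zeta> X \<Gamma> \<omega> \<le> ?r \<or>
        (\<exists>m. \<omega> \<in> bad (\<zeta> / 2 * Suc m) \<and> estimation_error M d n \<gamma> \<zeta> X \<Gamma> \<omega> \<le> 2 * \<zeta> * real d * Suc m)"
    proof (cases "\<omega> \<in> bad (\<zeta> / 2)")
      case False
      then show ?thesis
        using estimation_error_not_bad[OF \<omega> False sparse \<zeta>_pos q s] threshold_rate_le[OF q s]
        by linarith
    next
      case True
      then obtain m where m: "\<omega> \<in> bad (\<zeta> / 2 * Suc m)" "\<omega> \<notin> bad (\<zeta> / 2 * Suc (Suc m))"
        using level_exists[OF \<omega> \<zeta>_pos] by blast
      have "estimation_error M d n \<gamma> \<zeta> X \<Gamma> \<omega> \<le> real d * (\<zeta> / 2 * Suc (Suc m) + \<zeta>)"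
        using \<zeta>_pos by (intro estimation_error_not_bad_trivial \<omega> m(2)) auto
      also have "\<dots> = real d * (\<zeta> * (Suc (Suc m) / 2 + 1))"
        by (simp add: field_simps)
      \<comment> \<open>The coefficient is \<open>(m + 4) / 2\<close>, with equality for
        \<open>m = 0\<close>.\<close>
      also have "\<dots> \<le> real d * (\<zeta> * (2 * real (Suc m)))"
        using \<zeta>_pos by (intro mult_left_mono) auto
      also have "\<dots> = 2 * \<zeta> * real d * real (Suc m)"
        by (simp only: mult_ac)
      finally show ?thesis
        using m(1) by blast
    qed
  qed (use estimation_error_measurable estimation_error_nonneg bad_measurable level_moment_le r \<delta>_ge_4 in auto)
  also have "\<dots> \<le> 2 * ?r powr ?p"
    using \<zeta>_r by simp
  \<comment> \<open>The exponent \<open>\<delta> / 4\<close> is at least 1, so the factor 2 survives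
    the root as at most 2.\<close>
  also have "\<dots> \<le> 2 powr ?p * ?r powr ?p"
    using \<delta>_ge_4 powr_mono[of 1 ?p 2] by (intro mult_right_mono) auto
  also have "\<dots> = (2 * ?r) powr ?p"
    using r by (simp only: powr_mult)
  finally have "(\<integral>\<omega>. estimation_error M d n \<gamma> \<zeta> X \<Gamma> \<omega> powr ?p \<partial>M) powr (1 / ?p)
      \<le> ((2 * ?r) powr ?p) powr (1 / ?p)"
    using \<delta>_ge_4 by (intro powr_mono2) auto
  also have "\<dots> = 2 * ?r"
    using r \<delta>_ge_4 by (simp add: powr_powr)
  finally show ?thesis
    by simp
qed

end

lemma estimation_error_bounds:
  fixes M :: "'w measure" and X :: "nat \<Rightarrow> 'w \<Rightarrow> nat \<Rightarrow> real"
    and \<Gamma> :: "nat \<Rightarrow> nat \<Rightarrow> 'w \<Rightarrow> nat \<Rightarrow> real"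
  assumes C1: "2 \<le> C1" and C2: "64 * C1\<^sup>2 \<le> C2"
    and hyps: "prob_space M \<and> 1 \<le> d \<and> 0 \<le> \<sigma> \<and>
    iid_sample M d n X \<and>
    (\<forall>k<n. \<forall>i<d. (\<integral>\<omega>. X k \<omega> i \<partial>M) = 0) \<and>
    (\<forall>k<n. \<forall>i<d. psi2_norm M (\<lambda>\<omega>. X k \<omega> i) \<le> ennreal \<sigma>) \<and>
    0 \<le> q \<and> q < 1 \<and> 0 < s \<and> approx_sparse d q s (second_moment M (X 0)) \<and>
    4 \<le> \<delta> \<and> 2 * \<delta> * ln (real d) < real n \<and>
    \<gamma> = C1 * \<sigma> * sqrt (ln (real n / (2 * \<delta> * ln (real d)))) \<and>
    \<zeta> = C2 * noise_level \<sigma> \<delta> d n \<and>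
    \<sigma> < \<gamma> \<and>
    \<delta> * ln (real d) * (ln (real n))\<^sup>2 / real n \<le> c \<and>
    uniform_dithers M d n \<gamma> \<Gamma> \<and>
    dithers_indep_sample M d n X \<Gamma>"
  shows "(noise_level \<sigma> \<delta> d n powr q \<le> s \<longrightarrow>
      (\<integral>\<omega>. estimation_error M d n \<gamma> \<zeta> X \<Gamma> \<omega> powr (\<delta> / 4) \<partial>M) powr (1 / (\<delta> / 4))
        \<le> 4 * C2 * (s * noise_level \<sigma> \<delta> d n powr (1 - q))) \<and>
    measure M {\<omega> \<in> space M. estimation_error M d n \<gamma> \<zeta> X \<Gamma> \<omega>
        \<le> 4 * C2 * (s * noise_level \<sigma> \<delta> d n powr (1 - q))} \<ge> 1 - exp (- \<delta>)"
proof -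
  interpret prob_space M
    using hyps by blast
  \<comment> \<open>For \<open>d = 1\<close> the quotient is a division by 0, hence 0, and
    \<open>ln 0 = 0\<close>. Either case contradicts \<open>\<sigma> < \<gamma>\<close> with
    \<open>\<sigma>\<close> nonnegative.\<close>
  have "\<gamma> = 0" if "\<sigma> = 0 \<or> d = 1"
    using hyps that by auto
  then have "0 < \<sigma>" "2 \<le> d"
    using hyps by (force simp: less_eq_Suc_le)+
  moreover have "0 < n"
  proof -
    have "0 \<le> 2 * \<delta> * ln (real d)"
      using hyps by simp
    then have "0 < real n"
      using hyps by linarith
    then show ?thesis
      by simp
  qed
  ultimately interpret tuned_dithered_sample M d n \<sigma> \<gamma> X \<Gamma> \<delta> C1 C2
    using hyps C1 C2 by unfold_locales auto
  have "approx_sparse d q s cov" "0 \<le> q" "q < 1" "0 < s" and \<zeta>: "\<zeta> = C2 * \<nu>"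
    using hyps by blast+
  from error_moment[OF this(1-4)] error_high_probability[OF this(1-4)] show ?thesis
    unfolding \<zeta> by blast
qed

theorem theorem3:
  shows "\<exists>C1min>0. \<forall>C1\<ge>C1min. \<exists>C2min>0. \<forall>C2\<ge>C2min. \<exists>c>0. \<exists>K>0.
    \<forall>(M :: 'w measure) (d :: nat) (n :: nat) (\<sigma> :: real) (q :: real) (s :: real)
      (\<delta> :: real) (\<gamma> :: real) (\<zeta> :: real)
      (X :: nat \<Rightarrow> 'w \<Rightarrow> nat \<Rightarrow> real) (\<Gamma> :: nat \<Rightarrow> nat \<Rightarrow> 'w \<Rightarrow> nat \<Rightarrow> real).
      prob_space M \<and> 1 \<le> d \<and> 0 \<le> \<sigma> \<and>
      iid_sample M d n X \<and>
      (\<forall>k<n. \<forall>i<d. (\<integral>\<omega>. X k \<omega> i \<partial>M) = 0) \<and>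
      (\<forall>k<n. \<forall>i<d. psi2_norm M (\<lambda>\<omega>. X k \<omega> i) \<le> ennreal \<sigma>) \<and>
      0 \<le> q \<and> q < 1 \<and> 0 < s \<and> approx_sparse d q s (second_moment M (X 0)) \<and>
      4 \<le> \<delta> \<and> 2 * \<delta> * ln (real d) < real n \<and>
      \<gamma> = C1 * \<sigma> * sqrt (ln (real n / (2 * \<delta> * ln (real d)))) \<and>
      \<zeta> = C2 * noise_level \<sigma> \<delta> d n \<and>
      \<sigma> < \<gamma> \<and>
      \<delta> * ln (real d) * (ln (real n))\<^sup>2 / real n \<le> c \<and>
      uniform_dithers M d n \<gamma> \<Gamma> \<and>
      dithers_indep_sample M d n X \<Gamma>
      \<longrightarrow>
      (noise_level \<sigma> \<delta> d n powr q \<le> s \<longrightarrow>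
        (\<integral>\<omega>. estimation_error M d n \<gamma> \<zeta> X \<Gamma> \<omega> powr (\<delta> / 4) \<partial>M) powr (1 / (\<delta> / 4))
          \<le> K * (s * noise_level \<sigma> \<delta> d n powr (1 - q))) \<and>
      measure M {\<omega> \<in> space M. estimation_error M d n \<gamma> \<zeta> X \<Gamma> \<omega>
          \<le> K * (s * noise_level \<sigma> \<delta> d n powr (1 - q))} \<ge> 1 - exp (- \<delta>)"
  \<comment> \<open>The threshold 2 for \<open>C1\<close> serves the bias,
    \<open>64 * C1\<^sup>2\<close> for \<open>C2\<close> serves the Hoeffding exponent, and
    \<open>4 * C2\<close> is the constant of both error bounds.\<close>
  apply (rule exI[of _ 2], intro conjI allI impI, simp)
  apply (rule_tac x = "64 * C1\<^sup>2" in exI, intro conjI allI impI, force)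
  apply (rule exI[of _ 1], intro conjI, simp)
  apply (rule_tac x = "4 * C2" in exI, intro conjI)
  subgoal for C1 C2
    using power_mono[of 2 C1 2] by simp
  apply (intro allI impI estimation_error_bounds; assumption)
  done

end
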